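(* Let $\zeta$ be a subordinator with drift $c\ge0$, Lévy measure $\Pi$, Laplace exponent $\phi$ and $\mathbb{E}[\zeta_1]<\infty$. Suppose that for some $\alpha\ge0$, $$\lim_{x\to\infty}\frac{\overline{\Pi}(x+y)}{\overline{\Pi}(x)}=e^{-\alpha y}\qquad\text{for all }y\in\mathbb{R},$$ and that the renewal measure of $\zeta$ has a density which is non-increasing and convex. Let $Y=(Y_t,t\ge0)$ be the spectrally negative Lévy process drifting to $+\infty$ with Laplace exponent $\psi(\lambda)=\log\mathbb{E}[e^{\lambda Y_1}]=\lambda^2/\phi(\lambda)$, and let $k_\psi$ be the density of $I_\psi=\int_0^\infty e^{-Y_s}\,\mathrm{d}s$. Put $I=\int_0^\infty e^{-\zeta_s}\,\mathrm{d}s$ and $q^*=\big(c+\int_{(0,\infty)}x\,\Pi(\mathrm{d}x)\big)^{-1}$. Then $$k_\psi(x)\sim q^*\,\mathbb{E}\big[I^{-\alpha}\big]\,\frac1x\,\overline{\Pi}(\log x)\qquad\text{as }x\to\infty.$$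
   Context: A subordinator $\zeta$ is a Lévy process, issued from $0$, with non-decreasing paths; its Laplace exponent is $$\phi(\lambda)=-\log\mathbb{E}[e^{-\lambda\zeta_1}]=c\lambda+\int_{(0,\infty)}(1-e^{-\lambda x})\,\Pi(\mathrm{d}x),\qquad\lambda\ge0,$$ with $\int_{(0,\infty)}(1\wedge x)\Pi(\mathrm{d}x)<\infty$. Notation: $\overline{\Pi}(x)=\Pi(x,\infty)$ for $x>0$; $1/c=\infty$ if $c=0$; $f(x)\sim g(x)$ means $f(x)/g(x)\to1$. The renewal measure $U$ of $\zeta$ is defined by $\mathbb{E}[\int_0^\infty f(\zeta_t)\,\mathrm{d}t]=\int_{[0,\infty)}f(x)\,U(\mathrm{d}x)$ for every positive measurable $f$; having a density means being absolutely continuous with respect to Lebesgue measure. A spectrally negative Lévy process is one with no positive jumps. Known facts used to set up the statement: under the assumptions that $U$ has a non-increasing convex density and $\mathbb{E}[\zeta_1]<\infty$, a spectrally negative Lévy process $Y$ drifting to $+\infty$ with Laplace exponent $\psi(\lambda)=\lambda^2/\phi(\lambda)$ exists (Kyprianou and Rivero). Moreover (Rivero), the density $k_\psi$ of $I_\psi$ is given by $$k_\psi(x)=q^*\,\frac1x\,k\Big(\frac1x\Big),\qquad x>0,$$ where $k$ is the density of $I=\int_0^\infty e^{-\zeta_s}\,\mathrm{d}s$, taken to be the version, zero outside $(0,1/c)$, which satisfies $(1-cx)k(x)=\int_x^\infty\overline{\Pi}(\log(y/x))\,k(y)\,\mathrm{d}y$ for $x\in(0,1/c)$; this is the version of $k_\psi$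 referred to in the claim. *)

theory Defs
  imports "HOL-Probability.Probability"
begin

text \<open>
  Real-valued processes in continuous time are functions of type \<open>real \<Rightarrow> 'a \<Rightarrow> real\<close>;
  only the times \<open>t \<ge> 0\<close> matter. Path properties are required almost surely.
\<close>

locale levy_process = prob_space M for M :: "'a measure" +
  fixes X :: "real \<Rightarrow> 'a \<Rightarrow> real"
  assumes random_variable_at: "\<And>t. 0 \<le> t \<Longrightarrow> X t \<in> borel_measurable M"
    and starts_at_zero: "AE \<omega> in M. X 0 \<omega> = 0"
    and independent_increments:
      "\<And>(t :: nat \<Rightarrow> real) n. 0 \<le> t 0 \<Longrightarrow> mono t \<Longrightarrow>
        indep_vars (\<lambda>_. borel) (\<lambda>i \<omega>. X (t (Suc i)) \<omega> - X (t i) \<omega>) {..<n}"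
    and stationary_increments:
      "\<And>s t. 0 \<le> s \<Longrightarrow> 0 \<le> t \<Longrightarrow>
        distr M borel (\<lambda>\<omega>. X (s + t) \<omega> - X s \<omega>) = distr M borel (X t)"
    and cadlag_paths:
      "AE \<omega> in M. (\<forall>t\<ge>0. ((\<lambda>s. X s \<omega>) \<longlongrightarrow> X t \<omega>) (at_right t)) \<and>
        (\<forall>t>0. \<exists>l. ((\<lambda>s. X s \<omega>) \<longlongrightarrow> l) (at_left t))"

locale subordinator = levy_process +
  assumes nondecreasing_paths: "AE \<omega> in M. mono_on {0..} (\<lambda>t. X t \<omega>)"

locale spectrally_negative_levy_process = levy_process +
  assumes no_positive_jumps:
    "AE \<omega> in M. \<forall>t>0. \<forall>l. ((\<lambda>s. X s \<omega>) \<longlongrightarrow> l) (at_left t) \<longrightarrow> X t \<omega> \<le> l"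

definition drifts_to_infinity :: "'a measure \<Rightarrow> (real \<Rightarrow> 'a \<Rightarrow> real) \<Rightarrow> bool" where
  "drifts_to_infinity M X \<longleftrightarrow> (AE \<omega> in M. filterlim (\<lambda>t. X t \<omega>) at_top at_top)"

definition laplace_exponent :: "'a measure \<Rightarrow> (real \<Rightarrow> 'a \<Rightarrow> real) \<Rightarrow> real \<Rightarrow> real" where
  "laplace_exponent M \<zeta> l = - ln (\<integral>\<omega>. exp (- l * \<zeta> 1 \<omega>) \<partial>M)"

text \<open>
  The Levy measure is written \<open>\<nu>\<close>, as capital Pi is reserved syntax. It is a Borel measure
  on the reals carried by \<open>(0, \<infinity>)\<close>.
\<close>

definition subordinator_levy_measure :: "real measure \<Rightarrow> bool" where
  "subordinator_levy_measure \<nu> \<longleftrightarrow>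
     sets \<nu> = sets borel \<and> emeasure \<nu> {..0} = 0 \<and>
     (\<integral>\<^sup>+x\<in>{0<..}. ennreal (min 1 x) \<partial>\<nu>) < \<infinity>"

definition has_drift_and_levy_measure ::
  "'a measure \<Rightarrow> (real \<Rightarrow> 'a \<Rightarrow> real) \<Rightarrow> real \<Rightarrow> real measure \<Rightarrow> bool" where
  "has_drift_and_levy_measure M \<zeta> c \<nu> \<longleftrightarrow>
     0 \<le> c \<and> subordinator_levy_measure \<nu> \<and>
     (\<forall>l\<ge>0. laplace_exponent M \<zeta> l =
        c * l + (LINT x:{0<..}|\<nu>. 1 - exp (- l * x)))"

definition levy_tail :: "real measure \<Rightarrow> real \<Rightarrow> real" where
  "levy_tail \<nu> x = measure \<nu> {x<..}"

definition renewal_measure ::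
  "'a measure \<Rightarrow> (real \<Rightarrow> 'a \<Rightarrow> real) \<Rightarrow> real measure \<Rightarrow> bool" where
  "renewal_measure M \<zeta> U \<longleftrightarrow>
     sets U = sets borel \<and>
     (\<forall>f :: real \<Rightarrow> ennreal. f \<in> borel_measurable borel \<longrightarrow>
        (\<integral>\<^sup>+\<omega>. (\<integral>\<^sup>+t\<in>{0..}. f (\<zeta> t \<omega>) \<partial>lborel) \<partial>M) = (\<integral>\<^sup>+x. f x \<partial>U))"

text \<open>
  The density lives on the open half-line because it may be unbounded at \<open>0\<close>.
\<close>

definition has_nonincreasing_convex_density :: "real measure \<Rightarrow> bool" where
  "has_nonincreasing_convex_density U \<longleftrightarrow>
     (\<exists>u :: real \<Rightarrow> real.
        (\<forall>x>0. 0 \<le> u x) \<and> antimono_on {0<..} u \<and> convex_on {0<..} u \<and>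
        U = density lborel (\<lambda>x. ennreal (u x) * indicator {0<..} x))"

text \<open>
  The integral is \<open>0\<close> by convention on the event where it diverges. A law that has a
  density gives mass \<open>0\<close> to the point \<open>0\<close>, so \<open>has_pdf\<close> below entails that the
  functional is almost surely finite.
\<close>

definition exponential_functional :: "(real \<Rightarrow> 'a \<Rightarrow> real) \<Rightarrow> 'a \<Rightarrow> real" where
  "exponential_functional X \<omega> = (LBINT s:{0..}. exp (- X s \<omega>))"

definition has_pdf :: "'a measure \<Rightarrow> ('a \<Rightarrow> real) \<Rightarrow> (real \<Rightarrow> real) \<Rightarrow> bool" where
  "has_pdf M Z f \<longleftrightarrow> (\<forall>x. 0 \<le> f x) \<and> distributed M lborel Z (\<lambda>x. ennreal (f x))"

text \<open>The interval \<open>(0, 1/c)\<close> with \<open>1/c = \<infinity>\<close> for \<open>c = 0\<close>.\<close>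

definition inverse_drift_interval :: "real \<Rightarrow> real set" where
  "inverse_drift_interval c = {x. 0 < x \<and> (c = 0 \<or> x < 1 / c)}"

text \<open>
  A density is determined only almost everywhere; the integral equation of Carmona, Petit
  and Yor, required at every point, selects the version used for pointwise asymptotics. The
  integral is taken in the extended non-negative reals, so the equation includes finiteness.
\<close>

definition subordinator_functional_density ::
  "'a measure \<Rightarrow> (real \<Rightarrow> 'a \<Rightarrow> real) \<Rightarrow> real \<Rightarrow> real measure \<Rightarrow> (real \<Rightarrow> real) \<Rightarrow> bool" where
  "subordinator_functional_density M \<zeta> c \<nu> k \<longleftrightarrow>
     has_pdf M (exponential_functional \<zeta>) k \<and>
     (\<forall>x. x \<notin> inverse_drift_interval c \<longrightarrow> k x = 0) \<and>
     (\<forall>x\<in>inverse_drift_interval c.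
        ennreal ((1 - c * x) * k x) =
        (\<integral>\<^sup>+y\<in>{x<..}. ennreal (levy_tail \<nu> (ln (y / x)) * k y) \<partial>lborel))"

definition q_star :: "real \<Rightarrow> real measure \<Rightarrow> real" where
  "q_star c \<nu> = inverse (c + (LINT x:{0<..}|\<nu>. x))"

end

theory Submission
  imports Defs
begin

text \<open>
  The identity \<open>k\<^sub>\<psi> x = q * (1 / x) * k (1 / x)\<close> turns the claim into one about the density
  \<open>k\<close> of the exponential functional of the subordinator at the origin. Put
  \<open>L t = levy_tail \<nu> (- ln t)\<close> for \<open>0 < t < 1\<close> and \<open>L t = 0\<close> otherwise. The integral equation for \<open>k\<close> reads
  \<open>(1 - c x) k(x) = \<integral> L(x / y) k(y) dy\<close>, and the hypothesis on the tail says that \<open>L\<close> varies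
  regularly at \<open>0\<close> with index \<open>\<alpha>\<close>. For fixed \<open>y\<close>, \<open>L(x / y) / L(x)\<close> tends to \<open>y powr - \<alpha>\<close> as \<open>x\<close>
  decreases to \<open>0\<close>; so \<open>k(x) / L(x)\<close> should tend to \<open>\<integral> y powr - \<alpha> k(y) dy\<close>, which is the moment of order
  \<open>- \<alpha>\<close> of the functional. Two points need an argument.

  Domination for \<open>y \<ge> 2 x\<close>. Potter bounds give \<open>L(x / y) \<le> (C * y powr - p + 1) L(x)\<close> with \<open>p\<close> slightly
  above \<open>\<alpha>\<close>, so a moment of \<open>k\<close> of order \<open>- p\<close> must be finite. That of order \<open>-1\<close> is finite because
  \<open>k\<^sub>\<psi>\<close> is integrable. Multiplying the integral equation by a power of \<open>x\<close> and integrating expresses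
  the moment of order \<open>-1 - \<beta>\<close> through that of order \<open>- \<beta>\<close> for \<open>\<beta> < \<alpha>\<close>, so all orders in \<open>(-1 - \<alpha>, 0]\<close>
  are reached (\<open>inverse_moment_finite\<close>).

  The range \<open>x < y < 2 x\<close>. There \<open>L(x / y)\<close> may be unbounded, and its contribution is
  negligible once \<open>k \<le> A L\<close> near the origin (\<open>density_dominated_near_zero\<close>). This follows from an
  absorption argument: up to a cutoff, \<open>k / L\<close> is an integrable subsolution of an integral
  inequality whose kernel contracts both on bounded and on integrable functions when it
  is restricted to a small neighbourhood of \<open>0\<close>, and such subsolutions are bounded
  (\<open>integrable_subsolution_bounded\<close>).
\<close>

section \<open>Regularly varying kernels on the unit interval\<close>

text \<open>
  For the tail \<open>R\<close> of a measure on the half-line this describes \<open>L t = R (- ln t)\<close>: the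
  exponential decay of \<open>R\<close> at rate \<open>\<alpha>\<close> becomes regular variation of index \<open>\<alpha>\<close> at \<open>0\<close>, and a possible
  singularity of \<open>R\<close> at \<open>0\<close> becomes one at \<open>t = 1\<close>.
\<close>

locale regularly_varying_kernel =
  fixes L :: "real \<Rightarrow> real" and \<alpha> :: real
  assumes zero_outside: "\<And>t. t \<notin> {0<..<1} \<Longrightarrow> L t = 0"
    and pos: "\<And>t. 0 < t \<Longrightarrow> t < 1 \<Longrightarrow> 0 < L t"
    and mono: "\<And>s t. 0 < s \<Longrightarrow> s \<le> t \<Longrightarrow> t < 1 \<Longrightarrow> L s \<le> L t"
    and integral_finite: "(\<integral>\<^sup>+t. ennreal (L t) \<partial>lborel) < \<infinity>"
    and regular_variation: "\<And>t. 0 < t \<Longrightarrow> ((\<lambda>x. L (t * x) / L x) \<longlongrightarrow> t powr \<alpha>) (at_right 0)"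
    and index_nonneg: "0 \<le> \<alpha>"
begin

lemma nonneg: "0 \<le> L t"
  using zero_outside[of t] pos[of t] by (cases "t \<in> {0<..<1}") auto

lemma measurable_kernel [measurable]: "L \<in> borel_measurable borel"
proof -
  have "L \<in> borel_measurable (restrict_space borel {0<..<1})"
    by (rule borel_measurable_mono_on_fnc) (auto simp: mono_on_def intro: mono)
  then have "(\<lambda>t. indicator {0<..<1} t *\<^sub>R L t) \<in> borel_measurable borel"
    by (subst (asm) borel_measurable_restrict_space_iff) auto
  moreover have "(\<lambda>t. indicator {0<..<1} t *\<^sub>R L t) = L"
    using zero_outside by (auto simp: indicator_def fun_eq_iff)
  ultimately show ?thesis by simp
qed

lemma halving_near_zero:
  assumes "a < \<alpha>" "\<alpha> < b"
  obtains \<eta> where "0 < \<eta>" "\<eta> \<le> 1 / 2"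
    and "\<And>t. 0 < t \<Longrightarrow> t \<le> \<eta> \<Longrightarrow> L (t / 2) \<le> (1 / 2) powr a * L t"
    and "\<And>t. 0 < t \<Longrightarrow> t \<le> \<eta> \<Longrightarrow> (1 / 2) powr b * L t \<le> L (t / 2)"
proof -
  have lim: "((\<lambda>x. L (1 / 2 * x) / L x) \<longlongrightarrow> (1 / 2) powr \<alpha>) (at_right 0)"
    by (rule regular_variation) simp
  have "(1 / 2 :: real) powr \<alpha> < (1 / 2) powr a" "(1 / 2 :: real) powr b < (1 / 2) powr \<alpha>"
    using assms by (simp_all add: powr_less_mono' )
  then have "\<forall>\<^sub>F x in at_right 0. L (1 / 2 * x) / L x < (1 / 2) powr a \<and>
      (1 / 2) powr b < L (1 / 2 * x) / L x"
    using order_tendstoD[OF lim] by (auto intro: eventually_conj)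
  then obtain e where e: "e > 0" and le: "\<And>x. 0 < x \<Longrightarrow> x < e \<Longrightarrow>
      L (1 / 2 * x) / L x < (1 / 2) powr a \<and> (1 / 2) powr b < L (1 / 2 * x) / L x"
    unfolding eventually_at_right_field by auto
  show thesis
  proof (rule that[of "min (e / 2) (1 / 2)"])
    fix t :: real assume t: "0 < t" "t \<le> min (e / 2) (1 / 2)"
    then have "t < e" using e by auto
    then have *: "L (1 / 2 * t) / L t < (1 / 2) powr a" "(1 / 2) powr b < L (1 / 2 * t) / L t"
      using le t by auto
    have "0 < L t" using t pos by auto
    with * show "L (t / 2) \<le> (1 / 2) powr a * L t" "(1 / 2) powr b * L t \<le> L (t / 2)"
      by (auto simp: field_simps)
  qed (use e in auto)
qed

text \<open>
  The two Potter bounds iterate the estimates for one halving. Monotonicity of \<open>L\<close>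
  interpolates between dyadic points, and the range away from \<open>0\<close>, up to \<open>1 / 2\<close>, only affects
  the constant.
\<close>

lemma potter_upper:
  assumes "a < \<alpha>"
  obtains C where "0 < C" "\<And>t. 0 < t \<Longrightarrow> t \<le> 1 / 2 \<Longrightarrow> L t \<le> C * t powr a"
proof -
  obtain \<eta> where \<eta>: "0 < \<eta>" "\<eta> \<le> 1 / 2"
    and half: "\<And>t. 0 < t \<Longrightarrow> t \<le> \<eta> \<Longrightarrow> L (t / 2) \<le> (1 / 2) powr a * L t"
    using halving_near_zero[OF assms less_add_one] by metis
  define m where "m = min ((\<eta> / 2) powr a) ((1 / 2) powr a)"
  have m: "m > 0" unfolding m_def using \<eta> by auto
  define C where "C = L (1 / 2) / m"
  have L2: "L (1 / 2) > 0" by (rule pos) auto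
  have C: "C > 0" unfolding C_def using m L2 by auto
  have base: "L t \<le> C * t powr a" if t: "\<eta> / 2 \<le> t" "t \<le> 1 / 2" for t
  proof -
    have "m \<le> t powr a"
    proof (cases "a \<ge> 0")
      case True
      then have "(\<eta> / 2) powr a \<le> t powr a" using t \<eta> by (intro powr_mono2) auto
      then show ?thesis unfolding m_def by simp
    next
      case False
      then have "(1 / 2) powr a \<le> t powr a" using t \<eta> by (intro powr_mono2') auto
      then show ?thesis unfolding m_def by simp
    qed
    then have "L (1 / 2) \<le> C * t powr a" unfolding C_def using m L2 by (simp add: field_simps)
    moreover have "L t \<le> L (1 / 2)" using t \<eta> by (intro mono) auto
    ultimately show ?thesis by simp
  qed
  have step: "\<forall>t. \<eta> / 2 ^ n \<le> t \<longrightarrow> t \<le> 1 / 2 \<longrightarrow> L t \<le> C * t powr a" for n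
  proof (induction n)
    case 0
    then show ?case using base \<eta> by auto
  next
    case (Suc n)
    show ?case
    proof (intro allI impI)
      fix t assume t: "\<eta> / 2 ^ Suc n \<le> t" "t \<le> 1 / 2"
      have t0: "t > 0" using t(1) \<eta> by (smt (verit) divide_pos_pos zero_less_power)
      show "L t \<le> C * t powr a"
      proof (cases "\<eta> / 2 \<le> t")
        case True then show ?thesis using base t by auto
      next
        case False
        then have "L (2 * t / 2) \<le> (1 / 2) powr a * L (2 * t)"
          using t0 by (intro half) auto
        also have "L (2 * t) \<le> C * (2 * t) powr a"
          using Suc.IH t False \<eta> by (auto simp: field_simps)
        also have "(1 / 2) powr a * (C * (2 * t) powr a) = C * t powr a"
          using t0 by (simp add: powr_mult[symmetric] mult.left_commute)
        finally show ?thesis by simp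
      qed
    qed
  qed
  show thesis
  proof (rule that[OF C])
    fix t :: real assume t: "0 < t" "t \<le> 1 / 2"
    obtain n where "(1 / 2) ^ n < t / \<eta>" using real_arch_pow_inv[of "t / \<eta>" "1 / 2"] t \<eta> by auto
    then have "\<eta> / 2 ^ n \<le> t" using \<eta> by (simp add: field_simps power_one_over)
    then show "L t \<le> C * t powr a" using step t by auto
  qed
qed

lemma potter_lower:
  assumes "\<alpha> < p"
  obtains C where "0 < C"
    and "\<And>t y. 0 < t \<Longrightarrow> t \<le> 1 / 2 \<Longrightarrow> 0 < y \<Longrightarrow> y \<le> 1 \<Longrightarrow> L t \<le> C * y powr - p * L (t * y)"
proof -
  obtain \<eta> where \<eta>: "0 < \<eta>" "\<eta> \<le> 1 / 2"
    and half: "\<And>t. 0 < t \<Longrightarrow> t \<le> \<eta> \<Longrightarrow> (1 / 2) powr p * L t \<le> L (t / 2)"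
    using halving_near_zero[OF _ assms, of "\<alpha> - 1"] by (metis diff_less_eq less_add_one)
  have half': "L t \<le> 2 powr p * L (t / 2)" if "0 < t" "t \<le> \<eta>" for t
    using half[OF that] by (simp add: powr_divide field_simps)
  have p: "p > 0" using assms index_nonneg by simp
  have step: "\<forall>t y. 0 < t \<longrightarrow> t \<le> \<eta> \<longrightarrow> (1 / 2) ^ n \<le> y \<longrightarrow> y \<le> 1 \<longrightarrow>
      L t \<le> 2 powr p * y powr - p * L (t * y)" for n
  proof (induction n)
    case 0
    have "L t \<le> 2 powr p * L t" for t
      using nonneg[of t] p ge_one_powr_ge_zero[of 2 p] by (simp add: mult_le_cancel_right1)
    then show ?case by auto
  next
    case (Suc n)
    show ?case
    proof (intro allI impI)
      fix t y :: real assume ty: "0 < t" "t \<le> \<eta>" "(1 / 2) ^ Suc n \<le> y" "y \<le> 1"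
      have y0: "y > 0" using ty(3) by (smt (verit) zero_less_power half_gt_zero_iff)
      show "L t \<le> 2 powr p * y powr - p * L (t * y)"
      proof (cases "1 / 2 \<le> y")
        case True
        have "L t \<le> 2 powr p * L (t / 2)" using half' ty by auto
        also have "L (t / 2) \<le> L (t * y)"
        proof (rule mono)
          have "t * y \<le> t" using ty mult_left_le[of y t] by simp
          with ty \<eta> show "t * y < 1" by linarith
        qed (use True ty in auto)
        also have "L (t * y) \<le> y powr - p * L (t * y)"
          using nonneg[of "t * y"] powr_mono2'[of "- p" y 1] p y0 ty
          by (simp add: mult_le_cancel_right1)
        finally show ?thesis by (simp add: mult.assoc)
      next
        case False
        have "L t \<le> 2 powr p * (2 * y) powr - p * L (t * (2 * y))"
          using Suc.IH ty False by auto
        also have "\<dots> \<le> 2 powr p * (2 * y) powr - p * (2 powr p * L (t * (2 * y) / 2))"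
        proof (intro mult_left_mono half')
          have "t * (2 * y) \<le> t * 1" using ty False by (intro mult_left_mono) auto
          then show "t * (2 * y) \<le> \<eta>" using ty by linarith
        qed (use ty y0 in auto)
        also have "\<dots> = 2 powr p * y powr - p * L (t * y)"
          using y0 by (simp add: powr_mult powr_minus field_simps)
        finally show ?thesis by simp
      qed
    qed
  qed
  have main: "L t \<le> 2 powr p * y powr - p * L (t * y)"
    if ty: "0 < t" "t \<le> \<eta>" "0 < y" "y \<le> 1" for t y
  proof -
    obtain n where "(1 / 2) ^ n < y" using real_arch_pow_inv[of y "1 / 2"] ty by auto
    then show ?thesis using step[of n] ty by auto
  qed
  define r where "r = L (1 / 2) / L \<eta>"
  have L\<eta>: "L \<eta> > 0" using \<eta> by (intro pos) auto
  have r: "r \<ge> 1" unfolding r_def using L\<eta> \<eta> by (auto intro: mono)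
  show thesis
  proof (rule that[of "r * 2 powr p"])
    fix t y :: real assume ty: "0 < t" "t \<le> 1 / 2" "0 < y" "y \<le> 1"
    have nn: "0 \<le> 2 powr p * y powr - p * L (t * y)" using nonneg by simp
    show "L t \<le> r * 2 powr p * y powr - p * L (t * y)"
    proof (cases "t \<le> \<eta>")
      case True
      with main[of t y] ty have "L t \<le> 2 powr p * y powr - p * L (t * y)" by auto
      also have "\<dots> \<le> r * (2 powr p * y powr - p * L (t * y))"
        using nn r by (simp add: mult_le_cancel_right1)
      finally show ?thesis by (simp add: mult.assoc)
    next
      case False
      have "L (\<eta> * y) \<le> L (t * y)"
      proof (rule mono)
        have "t * y \<le> t" using ty mult_left_le[of y t] by simp
        with ty show "t * y < 1" by linarith
      qed (use False ty \<eta> in auto)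
      then have "2 powr p * y powr - p * L (\<eta> * y) \<le> 2 powr p * y powr - p * L (t * y)"
        by (intro mult_left_mono) auto
      moreover have "L \<eta> \<le> 2 powr p * y powr - p * L (\<eta> * y)" using main ty \<eta> by auto
      ultimately have "L \<eta> \<le> 2 powr p * y powr - p * L (t * y)" by linarith
      then have "r * L \<eta> \<le> r * (2 powr p * y powr - p * L (t * y))"
        using r by (intro mult_left_mono) auto
      moreover have "L t \<le> L (1 / 2)" using ty by (intro mono) auto
      moreover have "L (1 / 2) = r * L \<eta>" unfolding r_def using L\<eta> by simp
      ultimately show ?thesis by (simp add: mult.assoc)
    qed
  qed (use r in auto)
qed

lemma kernel_moment_finite:
  assumes "\<beta> < \<alpha>"
  shows "(\<integral>\<^sup>+t. ennreal (t powr (-1 - \<beta>) * L t) \<partial>lborel) < \<infinity>"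
proof -
  define a where "a = (\<alpha> + \<beta>) / 2"
  have a: "a < \<alpha>" "\<beta> < a" unfolding a_def using assms by auto
  obtain C where C: "0 < C" "\<And>t. 0 < t \<Longrightarrow> t \<le> 1 / 2 \<Longrightarrow> L t \<le> C * t powr a"
    using potter_upper[OF a(1)] by metis
  define g where "g t = indicator {0<..1 / 2} t * t powr (a - \<beta> - 1)" for t :: real
  define m where "m = max 1 ((1 / 2) powr (-1 - \<beta>))"
  have [measurable]: "g \<in> borel_measurable borel" unfolding g_def by measurable
  have "(\<lambda>t. t powr (a - \<beta> - 1)) integrable_on {0<..1 / 2}"
    using a by (intro integrable_on_powr_from_0') auto
  then obtain I where "((\<lambda>t. t powr (a - \<beta> - 1)) has_integral I) {0<..1 / 2}" by blast
  from nn_integral_has_integral_lebesgue[OF _ this]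
  have g_fin: "(\<integral>\<^sup>+t. ennreal (g t) \<partial>lborel) < \<infinity>"
    unfolding g_def by simp
  have "t powr (-1 - \<beta>) * L t \<le> C * g t + m * L t" for t
  proof (cases "t \<in> {0<..<1}")
    case False
    then show ?thesis using zero_outside C by (simp add: g_def)
  next
    case t: True
    show ?thesis
    proof (cases "t \<le> 1 / 2")
      case True
      have "t powr (-1 - \<beta>) * L t \<le> t powr (-1 - \<beta>) * (C * t powr a)"
        using C t True by (intro mult_left_mono) auto
      also have "\<dots> = C * g t"
        using t True by (simp add: g_def powr_add[symmetric] algebra_simps)
      finally show ?thesis using nonneg[of t] by (smt (verit) m_def mult_nonneg_nonneg)
    next
      case False
      have "t powr (-1 - \<beta>) \<le> m"
      proof (cases "-1 - \<beta> \<ge> 0")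
        case True
        then have "t powr (-1 - \<beta>) \<le> 1 powr (-1 - \<beta>)" using t by (intro powr_mono2) auto
        then show ?thesis unfolding m_def by simp
      next
        case neg: False
        then have "t powr (-1 - \<beta>) \<le> (1 / 2) powr (-1 - \<beta>)"
          using t False by (intro powr_mono2') auto
        then show ?thesis unfolding m_def by simp
      qed
      then have "t powr (-1 - \<beta>) * L t \<le> m * L t" using nonneg by (intro mult_right_mono)
      then show ?thesis using C False by (simp add: g_def)
    qed
  qed
  then have "(\<integral>\<^sup>+t. ennreal (t powr (-1 - \<beta>) * L t) \<partial>lborel) \<le>
      (\<integral>\<^sup>+t. ennreal C * ennreal (g t) + ennreal m * ennreal (L t) \<partial>lborel)"
    using C nonneg
    by (intro nn_integral_mono)
       (auto simp: ennreal_mult'[symmetric] ennreal_plus[symmetric] g_def m_def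
             simp del: ennreal_plus intro!: ennreal_leI)
  also have "\<dots> = ennreal C * (\<integral>\<^sup>+t. ennreal (g t) \<partial>lborel) +
      ennreal m * (\<integral>\<^sup>+t. ennreal (L t) \<partial>lborel)"
    by (simp add: nn_integral_add nn_integral_cmult)
  also have "\<dots> < \<infinity>"
    using g_fin integral_finite by (simp add: ennreal_mult_less_top)
  finally show ?thesis .
qed

definition mass :: real where "mass = enn2real (\<integral>\<^sup>+t. ennreal (L t) \<partial>lborel)"

lemma ennreal_mass: "ennreal mass = (\<integral>\<^sup>+t. ennreal (L t) \<partial>lborel)"
  unfolding mass_def using integral_finite by simp

lemma mass_nonneg: "0 \<le> mass" unfolding mass_def by simp

text \<open>
  Monotonicity and integrability limit the blow-up at \<open>1\<close>: one factor \<open>1 - t\<close> tames it.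
\<close>

lemma singularity_bound: "L t * (1 - t) \<le> mass"
proof (cases "t \<in> {0<..<1}")
  case False
  then show ?thesis using zero_outside mass_nonneg by simp
next
  case True
  have "ennreal (L t * (1 - t)) = (\<integral>\<^sup>+s. ennreal (L t) * indicator {t..<1} s \<partial>lborel)"
    using True nonneg by (simp add: nn_integral_cmult ennreal_mult)
  also have "\<dots> \<le> (\<integral>\<^sup>+s. ennreal (L s) \<partial>lborel)"
    using True by (intro nn_integral_mono) (auto simp: indicator_def intro!: ennreal_leI mono)
  finally show ?thesis using mass_nonneg by (simp add: ennreal_mass[symmetric])
qed

lemma doubling:
  obtains C where "0 < C" "\<And>x y. 0 < x \<Longrightarrow> x \<le> y \<Longrightarrow> y \<le> 2 * x \<Longrightarrow> x \<le> 1 / 4 \<Longrightarrow> L y \<le> C * L x"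
proof -
  obtain C where C: "0 < C"
    "\<And>t y. 0 < t \<Longrightarrow> t \<le> 1 / 2 \<Longrightarrow> 0 < y \<Longrightarrow> y \<le> 1 \<Longrightarrow> L t \<le> C * y powr - (\<alpha> + 1) * L (t * y)"
    using potter_lower[OF less_add_one] by metis
  show thesis
  proof (rule that[of "C * (1 / 2) powr - (\<alpha> + 1)"])
    fix x y :: real assume xy: "0 < x" "x \<le> y" "y \<le> 2 * x" "x \<le> 1 / 4"
    have "L y \<le> L (2 * x)" using xy by (intro mono) auto
    also have "\<dots> \<le> C * (1 / 2) powr - (\<alpha> + 1) * L (2 * x * (1 / 2))"
      using xy by (intro C(2)) auto
    finally show "L y \<le> C * (1 / 2) powr - (\<alpha> + 1) * L x" by simp
  qed (use C in auto)
qed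

lemma power_lower_bound:
  assumes "\<alpha> < p"
  obtains C where "0 < C" "\<And>x. 0 < x \<Longrightarrow> x \<le> 1 / 2 \<Longrightarrow> 1 \<le> C * (2 * x) powr - p * L x"
proof -
  obtain C where C: "0 < C"
    "\<And>t y. 0 < t \<Longrightarrow> t \<le> 1 / 2 \<Longrightarrow> 0 < y \<Longrightarrow> y \<le> 1 \<Longrightarrow> L t \<le> C * y powr - p * L (t * y)"
    using potter_lower[OF assms] by metis
  have L2: "L (1 / 2) > 0" by (rule pos) auto
  show thesis
  proof (rule that[of "C / L (1 / 2)"])
    fix x :: real assume "0 < x" "x \<le> 1 / 2"
    then have "L (1 / 2) \<le> C * (2 * x) powr - p * L (1 / 2 * (2 * x))" by (intro C(2)) auto
    then show "1 \<le> C / L (1 / 2) * (2 * x) powr - p * L x" using L2 by (simp add: field_simps)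
  qed (use C L2 in auto)
qed

text \<open>
  For \<open>y \<le> 1\<close> this is the Potter bound, with \<open>x / y\<close> at most \<open>1 / 2\<close> to stay off the singularity;
  for \<open>y > 1\<close> it is monotonicity.
\<close>

lemma far_domination:
  assumes "\<alpha> < p"
  obtains C where "0 < C"
    "\<And>x y. 0 < x \<Longrightarrow> x < 1 \<Longrightarrow> 0 < y \<Longrightarrow> x / y < 1 / 2 \<Longrightarrow> L (x / y) \<le> (C * y powr - p + 1) * L x"
proof -
  obtain C where C: "0 < C"
    "\<And>t y. 0 < t \<Longrightarrow> t \<le> 1 / 2 \<Longrightarrow> 0 < y \<Longrightarrow> y \<le> 1 \<Longrightarrow> L t \<le> C * y powr - p * L (t * y)"
    using potter_lower[OF assms] by metis
  show thesis
  proof (rule that[OF C(1)])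
    fix x y :: real assume xy: "0 < x" "x < 1" "0 < y" "x / y < 1 / 2"
    show "L (x / y) \<le> (C * y powr - p + 1) * L x"
    proof (cases "y \<le> 1")
      case True
      have "L (x / y) \<le> C * y powr - p * L (x / y * y)" using xy True by (intro C(2)) auto
      then show ?thesis using xy nonneg[of x] by (simp add: distrib_right)
    next
      case False
      have "L (x / y) \<le> L x" using xy False by (intro mono) (auto simp: field_simps)
      also have "\<dots> \<le> (C * y powr - p + 1) * L x"
        using nonneg[of x] C(1) by (simp add: mult_le_cancel_right1)
      finally show ?thesis .
    qed
  qed
qed

text \<open>
  Splitting the kernel at \<open>1 / 2\<close> separates its singularity at \<open>1\<close> (\<open>x < y \<le> 2 x\<close> when
  \<open>t = x / y\<close>) from its regular variation at \<open>0\<close>.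
\<close>

definition near :: "real \<Rightarrow> real" where "near t = (if 1 / 2 \<le> t then L t else 0)"

definition far :: "real \<Rightarrow> real" where "far t = (if t < 1 / 2 then L t else 0)"

lemma near_measurable [measurable]: "near \<in> borel_measurable borel"
  unfolding near_def by measurable

lemma far_measurable [measurable]: "far \<in> borel_measurable borel"
  unfolding far_def by measurable

lemma near_nonneg: "0 \<le> near t" and far_nonneg: "0 \<le> far t"
  using nonneg by (auto simp: near_def far_def)

lemma near_plus_far: "near t + far t = L t"
  by (simp add: near_def far_def)

lemma near_nonzero:
  assumes "near (x / y) \<noteq> 0" "0 < x"
  shows "x < y" "y \<le> 2 * x"
proof -
  have xy: "1 / 2 \<le> x / y" using assms by (auto simp: near_def split: if_splits)
  then have y: "0 < y" using assms(2) by (smt (verit) divide_nonneg_nonpos divide_pos_pos)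
  then show "y \<le> 2 * x" using xy by (simp add: field_simps)
  have "x / y < 1"
    using assms(1) xy zero_outside[of "x / y"] by (auto simp: near_def split: if_splits)
  then show "x < y" using y by (simp add: field_simps)
qed

text \<open>
  On \<open>x < y \<le> 2 x\<close> the quotient \<open>x / y\<close> is convex in \<open>y\<close>, so it lies below its chord
  \<open>3 / 2 - y / (2 x)\<close>; this makes the substitution affine.
\<close>

lemma near_row_integral:
  assumes "0 < x"
  shows "(\<integral>\<^sup>+y. ennreal (near (x / y)) \<partial>lborel) \<le> ennreal (2 * x * mass)"
proof -
  have "(\<integral>\<^sup>+y. ennreal (near (x / y)) \<partial>lborel) \<le>
      (\<integral>\<^sup>+y. ennreal (L (3 / 2 + (- 1 / (2 * x)) * y)) \<partial>lborel)"
  proof (intro nn_integral_mono ennreal_leI)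
    fix y
    show "near (x / y) \<le> L (3 / 2 + (- 1 / (2 * x)) * y)"
    proof (cases "near (x / y) = 0")
      case True then show ?thesis using nonneg by simp
    next
      case False
      note xy = near_nonzero[OF False assms]
      have "near (x / y) \<le> L (x / y)" using far_nonneg[of "x / y"] near_plus_far[of "x / y"] by linarith
      also have "\<dots> \<le> L (3 / 2 + (- 1 / (2 * x)) * y)"
      proof (rule mono)
        have "0 \<le> (y - x) * (2 * x - y)" using xy by (intro mult_nonneg_nonneg) auto
        then show "x / y \<le> 3 / 2 + (- 1 / (2 * x)) * y"
          using xy assms by (simp add: field_simps power2_eq_square)
        show "3 / 2 + (- 1 / (2 * x)) * y < 1"
          using xy assms by (simp add: field_simps)
      qed (use xy assms in auto)
      finally show ?thesis .
    qed
  qed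
  also have "\<dots> = ennreal (2 * x * mass)"
  proof -
    have "ennreal (2 * x * mass) = ennreal (2 * x) * (\<integral>\<^sup>+t. ennreal (L t) \<partial>lborel)"
      using assms by (simp add: ennreal_mult' ennreal_mass)
    also have "(\<integral>\<^sup>+t. ennreal (L t) \<partial>lborel) =
        ennreal (1 / (2 * x)) * (\<integral>\<^sup>+y. ennreal (L (3 / 2 + (- 1 / (2 * x)) * y)) \<partial>lborel)"
      using assms
      by (subst nn_integral_real_affine[where c = "- 1 / (2 * x)" and t = "3 / 2"]) auto
    also have "ennreal (2 * x) * (ennreal (1 / (2 * x)) *
          (\<integral>\<^sup>+y. ennreal (L (3 / 2 + (- 1 / (2 * x)) * y)) \<partial>lborel)) =
        ennreal (2 * x * (1 / (2 * x))) * (\<integral>\<^sup>+y. ennreal (L (3 / 2 + (- 1 / (2 * x)) * y)) \<partial>lborel)"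
      using assms by (subst ennreal_mult) (auto simp: mult.assoc)
    finally show ?thesis using assms by simp
  qed
  finally show ?thesis .
qed

lemma near_column_integral:
  assumes "0 < y"
  shows "(\<integral>\<^sup>+x. ennreal (near (x / y)) \<partial>lborel) \<le> ennreal (y * mass)"
proof -
  have "(\<integral>\<^sup>+x. ennreal (near (x / y)) \<partial>lborel) \<le> (\<integral>\<^sup>+x. ennreal (L (x / y)) \<partial>lborel)"
    using far_nonneg near_plus_far
    by (intro nn_integral_mono ennreal_leI) (metis le_add_same_cancel1)
  also have "\<dots> = ennreal (y * mass)"
    using assms
    by (subst nn_integral_real_affine[where c = y and t = 0])
       (auto simp: ennreal_mult' ennreal_mass)
  finally show ?thesis .
qed

end

section \<open>A bound for integrable subsolutions\<close>

text \<open>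
  The kernel contracts by \<open>1/2\<close> both on bounded and on integrable functions. The excess
  \<open>h\<close> of \<open>f\<close> over \<open>2 A\<close> then satisfies \<open>h \<le> G h\<close>: the row bound absorbs the constant. Integrating
  and using the column bound, the integral of \<open>h\<close> is at most half of itself, so \<open>h\<close> is null;
  since only integrals of \<open>h\<close> occur on the right-hand side, \<open>h\<close> then vanishes everywhere and
  not only almost everywhere.
\<close>

lemma integrable_subsolution_bounded:
  fixes f :: "real \<Rightarrow> real" and G :: "real \<Rightarrow> real \<Rightarrow> real"
  assumes [measurable]: "f \<in> borel_measurable borel"
    and G [measurable]: "(\<lambda>(x, y). G x y) \<in> borel_measurable (borel \<Otimes>\<^sub>M borel)"
    and fin: "(\<integral>\<^sup>+x. ennreal (f x) \<partial>lborel) < \<infinity>"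
    and "0 \<le> A"
    and sub: "\<And>x. 0 < f x \<Longrightarrow>
      ennreal (f x) \<le> ennreal A + (\<integral>\<^sup>+y. ennreal (G x y) * ennreal (f y) \<partial>lborel)"
    and row: "\<And>x. 0 < f x \<Longrightarrow> (\<integral>\<^sup>+y. ennreal (G x y) \<partial>lborel) \<le> ennreal (1 / 2)"
    and col: "\<And>y. 0 < f y \<Longrightarrow> (\<integral>\<^sup>+x. ennreal (G x y) \<partial>lborel) \<le> ennreal (1 / 2)"
  shows "f x \<le> 2 * A"
proof -
  define h where "h x = max 0 (f x - 2 * A)" for x
  have [measurable]: "h \<in> borel_measurable borel" unfolding h_def by measurable
  have f_le: "f y \<le> 2 * A + h y" for y unfolding h_def by auto
  have h_le: "ennreal (h x) \<le> (\<integral>\<^sup>+y. ennreal (G x y) * ennreal (h y) \<partial>lborel)" for x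
  proof (cases "0 < f x")
    case False
    then show ?thesis using \<open>0 \<le> A\<close> by (simp add: h_def)
  next
    case True
    have "ennreal (f x) \<le> ennreal A + (\<integral>\<^sup>+y. ennreal (G x y) * ennreal (f y) \<partial>lborel)"
      by (rule sub) fact
    also have "(\<integral>\<^sup>+y. ennreal (G x y) * ennreal (f y) \<partial>lborel) \<le>
        (\<integral>\<^sup>+y. ennreal (2 * A) * ennreal (G x y) + ennreal (G x y) * ennreal (h y) \<partial>lborel)"
    proof (intro nn_integral_mono)
      fix y
      have "ennreal (f y) \<le> ennreal (2 * A) + ennreal (h y)"
        using f_le[of y] \<open>0 \<le> A\<close>
        by (subst ennreal_plus[symmetric]) (auto simp: h_def simp del: ennreal_plus intro: ennreal_leI)
      from mult_left_mono[OF this, of "ennreal (G x y)"]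
      show "ennreal (G x y) * ennreal (f y) \<le>
          ennreal (2 * A) * ennreal (G x y) + ennreal (G x y) * ennreal (h y)"
        by (simp add: distrib_left mult.commute)
    qed
    also have "\<dots> = ennreal (2 * A) * (\<integral>\<^sup>+y. ennreal (G x y) \<partial>lborel) +
        (\<integral>\<^sup>+y. ennreal (G x y) * ennreal (h y) \<partial>lborel)"
      by (simp add: nn_integral_add nn_integral_cmult)
    also have "ennreal (2 * A) * (\<integral>\<^sup>+y. ennreal (G x y) \<partial>lborel) \<le>
        ennreal (2 * A) * ennreal (1 / 2)"
      using row[OF True] by (intro mult_left_mono) auto
    also have "\<dots> = ennreal A" using \<open>0 \<le> A\<close> by (subst ennreal_mult'[symmetric]) auto
    finally have "ennreal (f x) \<le> ennreal A + (ennreal A +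
        (\<integral>\<^sup>+y. ennreal (G x y) * ennreal (h y) \<partial>lborel))"
      by (simp add: add_mono)
    then have le: "ennreal (f x) \<le> ennreal (2 * A) +
        (\<integral>\<^sup>+y. ennreal (G x y) * ennreal (h y) \<partial>lborel)"
      using \<open>0 \<le> A\<close> by (simp add: add.assoc[symmetric] ennreal_plus[symmetric] del: ennreal_plus)
    have "ennreal (h x) = ennreal (f x) - ennreal (2 * A)"
      using \<open>0 \<le> A\<close> by (auto simp: h_def ennreal_minus max_def ennreal_neg)
    also have "\<dots> \<le> (\<integral>\<^sup>+y. ennreal (G x y) * ennreal (h y) \<partial>lborel)"
      using le by (intro ennreal_minus_le_iff[THEN iffD2]) auto
    finally show ?thesis .
  qed
  have h_f: "h x \<le> max 0 (f x)" for x unfolding h_def using \<open>0 \<le> A\<close> by auto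
  have "(\<integral>\<^sup>+x. ennreal (h x) \<partial>lborel) \<le> (\<integral>\<^sup>+x. ennreal (f x) \<partial>lborel)"
    using h_f by (intro nn_integral_mono) (metis ennreal_leI ennreal_max_0)
  with fin have h_fin: "(\<integral>\<^sup>+x. ennreal (h x) \<partial>lborel) < \<infinity>" by (simp add: order.strict_trans1)
  have "(\<integral>\<^sup>+x. ennreal (h x) \<partial>lborel) \<le>
      (\<integral>\<^sup>+x. (\<integral>\<^sup>+y. ennreal (G x y) * ennreal (h y) \<partial>lborel) \<partial>lborel)"
    by (intro nn_integral_mono h_le)
  also have "\<dots> = (\<integral>\<^sup>+y. (\<integral>\<^sup>+x. ennreal (G x y) * ennreal (h y) \<partial>lborel) \<partial>lborel)"
    by (intro lborel_pair.Fubini') measurable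
  also have "\<dots> \<le> (\<integral>\<^sup>+y. ennreal (1 / 2) * ennreal (h y) \<partial>lborel)"
  proof (intro nn_integral_mono)
    fix y
    show "(\<integral>\<^sup>+x. ennreal (G x y) * ennreal (h y) \<partial>lborel) \<le> ennreal (1 / 2) * ennreal (h y)"
    proof (cases "0 < f y")
      case False
      then show ?thesis using \<open>0 \<le> A\<close> by (simp add: h_def)
    next
      case True
      then show ?thesis using col by (simp add: nn_integral_multc mult_right_mono)
    qed
  qed
  also have "\<dots> = ennreal (1 / 2) * (\<integral>\<^sup>+x. ennreal (h x) \<partial>lborel)"
    by (simp add: nn_integral_cmult)
  finally have "(\<integral>\<^sup>+x. ennreal (h x) \<partial>lborel) \<le> ennreal (1 / 2) * (\<integral>\<^sup>+x. ennreal (h x) \<partial>lborel)" .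
  then have "(\<integral>\<^sup>+x. ennreal (h x) \<partial>lborel) = 0"
    using h_fin
  proof (cases "(\<integral>\<^sup>+x. ennreal (h x) \<partial>lborel)")
    case (real r)
    assume "(\<integral>\<^sup>+x. ennreal (h x) \<partial>lborel) \<le> ennreal (1 / 2) * (\<integral>\<^sup>+x. ennreal (h x) \<partial>lborel)"
    then have "ennreal r \<le> ennreal (1 / 2 * r)"
      unfolding real by (subst ennreal_mult') auto
    then show ?thesis using real by simp
  qed simp
  then have h0: "AE y in lborel. ennreal (h y) = 0"
    by (subst (asm) nn_integral_0_iff_AE) auto
  have "(\<integral>\<^sup>+y. ennreal (G x y) * ennreal (h y) \<partial>lborel) = (\<integral>\<^sup>+(y::real). 0 \<partial>lborel)"
    using h0 by (intro nn_integral_cong_AE) (auto elim: eventually_mono)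
  with h_le[of x] have "ennreal (h x) = 0" by simp
  then have "h x \<le> 0" by (simp add: ennreal_eq_0_iff)
  then show ?thesis unfolding h_def by simp
qed

section \<open>Inverse moments of solutions of the integral equation\<close>

text \<open>
  The equation of Carmona, Petit and Yor for the density \<open>k\<close>, in multiplicative form.
\<close>

locale renewal_density_equation = regularly_varying_kernel L \<alpha>
  for L :: "real \<Rightarrow> real" and \<alpha> :: real +
  fixes k :: "real \<Rightarrow> real" and c :: real
  assumes k_nonneg: "\<And>x. 0 \<le> k x"
    and k_measurable [measurable]: "k \<in> borel_measurable borel"
    and k_integral: "(\<integral>\<^sup>+x. ennreal (k x) \<partial>lborel) = 1"
    and k_support: "\<And>x. x \<notin> inverse_drift_interval c \<Longrightarrow> k x = 0"
    and drift_nonneg: "0 \<le> c"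
    and equation: "\<And>x. x \<in> inverse_drift_interval c \<Longrightarrow>
      ennreal ((1 - c * x) * k x) = (\<integral>\<^sup>+y. ennreal (L (x / y) * k y) \<partial>lborel)"
    and first_inverse_moment: "(\<integral>\<^sup>+x. ennreal (k x / x) \<partial>lborel) < \<infinity>"
begin

lemma k_zero: "x \<le> 0 \<Longrightarrow> k x = 0"
  using k_support by (auto simp: inverse_drift_interval_def)

lemma dilation_integral:
  assumes "0 < y"
  shows "(\<integral>\<^sup>+x. ennreal (x powr (-1 - \<beta>) * L (x / y)) \<partial>lborel) =
    ennreal (y powr - \<beta>) * (\<integral>\<^sup>+t. ennreal (t powr (-1 - \<beta>) * L t) \<partial>lborel)"
proof -
  have "(\<integral>\<^sup>+x. ennreal (x powr (-1 - \<beta>) * L (x / y)) \<partial>lborel) =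
      ennreal y * (\<integral>\<^sup>+t. ennreal ((y * t) powr (-1 - \<beta>) * L t) \<partial>lborel)"
    using assms
    by (subst nn_integral_real_affine[where c = y and t = 0]) (auto simp: ac_simps)
  also have "\<dots> = (\<integral>\<^sup>+t. ennreal y * ennreal ((y * t) powr (-1 - \<beta>) * L t) \<partial>lborel)"
    by (rule nn_integral_cmult[symmetric]) measurable
  also have "\<dots> = (\<integral>\<^sup>+t. ennreal (y powr - \<beta>) * ennreal (t powr (-1 - \<beta>) * L t) \<partial>lborel)"
  proof (intro nn_integral_cong)
    fix t
    show "ennreal y * ennreal ((y * t) powr (-1 - \<beta>) * L t) =
        ennreal (y powr - \<beta>) * ennreal (t powr (-1 - \<beta>) * L t)"
    proof (cases "t \<in> {0<..<1}")
      case True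
      have "y * y powr (-1 - \<beta>) = y powr - \<beta>"
        using assms powr_add[of y 1 "-1 - \<beta>"] by simp
      then have "y * ((y * t) powr (-1 - \<beta>) * L t) = y powr - \<beta> * (t powr (-1 - \<beta>) * L t)"
        using assms True by (simp add: powr_mult mult.assoc[symmetric])
      then show ?thesis using assms nonneg by (simp add: ennreal_mult'[symmetric])
    qed (use zero_outside in simp)
  qed
  also have "\<dots> = ennreal (y powr - \<beta>) * (\<integral>\<^sup>+t. ennreal (t powr (-1 - \<beta>) * L t) \<partial>lborel)"
    by (rule nn_integral_cmult) measurable
  finally show ?thesis .
qed

text \<open>
  The right-hand side of the equation is a multiplicative convolution, so multiplying by
  \<open>x powr (-1 - \<beta>)\<close> and integrating factorises it into a moment of \<open>k\<close> of order \<open>- \<beta>\<close> and a moment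
  of the kernel, finite because \<open>\<beta> < \<alpha>\<close>. The factor \<open>1 - c x\<close> on the left is harmless: it degenerates
  only away from \<open>0\<close>, where the weight is bounded.
\<close>

lemma inverse_moment_step:
  assumes "\<beta> < \<alpha>" "0 \<le> \<beta>"
    and fin: "(\<integral>\<^sup>+y. ennreal (y powr - \<beta> * k y) \<partial>lborel) < \<infinity>"
  shows "(\<integral>\<^sup>+y. ennreal (y powr (-1 - \<beta>) * k y) \<partial>lborel) < \<infinity>"
proof -
  define H where "H = (\<integral>\<^sup>+t. ennreal (t powr (-1 - \<beta>) * L t) \<partial>lborel)"
  have H: "H < \<infinity>" unfolding H_def by (rule kernel_moment_finite) fact
  have "(\<integral>\<^sup>+x. ennreal (x powr (-1 - \<beta>)) * ennreal ((1 - c * x) * k x) \<partial>lborel) \<le>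
      (\<integral>\<^sup>+x. (\<integral>\<^sup>+y. ennreal (x powr (-1 - \<beta>) * L (x / y)) * ennreal (k y) \<partial>lborel) \<partial>lborel)"
  proof (intro nn_integral_mono)
    fix x
    show "ennreal (x powr (-1 - \<beta>)) * ennreal ((1 - c * x) * k x) \<le>
        (\<integral>\<^sup>+y. ennreal (x powr (-1 - \<beta>) * L (x / y)) * ennreal (k y) \<partial>lborel)"
    proof (cases "x \<in> inverse_drift_interval c")
      case True
      have "ennreal (x powr (-1 - \<beta>)) * ennreal ((1 - c * x) * k x) =
          (\<integral>\<^sup>+y. ennreal (x powr (-1 - \<beta>)) * ennreal (L (x / y) * k y) \<partial>lborel)"
        unfolding equation[OF True] by (rule nn_integral_cmult[symmetric]) measurable
      also have "\<dots> = (\<integral>\<^sup>+y. ennreal (x powr (-1 - \<beta>) * L (x / y)) * ennreal (k y) \<partial>lborel)"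
        using nonneg k_nonneg by (simp add: ennreal_mult mult.assoc)
      finally show ?thesis by simp
    qed (use k_support in simp)
  qed
  also have "\<dots> =
      (\<integral>\<^sup>+y. (\<integral>\<^sup>+x. ennreal (x powr (-1 - \<beta>) * L (x / y)) * ennreal (k y) \<partial>lborel) \<partial>lborel)"
    by (intro lborel_pair.Fubini') measurable
  also have "\<dots> = (\<integral>\<^sup>+y. H * ennreal (y powr - \<beta> * k y) \<partial>lborel)"
  proof (intro nn_integral_cong)
    fix y
    show "(\<integral>\<^sup>+x. ennreal (x powr (-1 - \<beta>) * L (x / y)) * ennreal (k y) \<partial>lborel) =
        H * ennreal (y powr - \<beta> * k y)"
    proof (cases "0 < y")
      case True
      have "(\<integral>\<^sup>+x. ennreal (x powr (-1 - \<beta>) * L (x / y)) * ennreal (k y) \<partial>lborel) =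
          (\<integral>\<^sup>+x. ennreal (x powr (-1 - \<beta>) * L (x / y)) \<partial>lborel) * ennreal (k y)"
        by (rule nn_integral_multc) measurable
      also have "\<dots> = ennreal (y powr - \<beta>) * H * ennreal (k y)"
        by (simp only: dilation_integral[OF True] H_def)
      finally show ?thesis using k_nonneg[of y] by (simp add: ennreal_mult ac_simps)
    qed (simp add: k_zero)
  qed
  also have "\<dots> = H * (\<integral>\<^sup>+y. ennreal (y powr - \<beta> * k y) \<partial>lborel)"
    by (rule nn_integral_cmult) measurable
  also have "\<dots> < \<infinity>" using H fin by (simp add: ennreal_mult_less_top)
  finally have weighted:
    "(\<integral>\<^sup>+x. ennreal (x powr (-1 - \<beta>)) * ennreal ((1 - c * x) * k x) \<partial>lborel) < \<infinity>" .
  define m where "m = (1 / (2 * c)) powr (-1 - \<beta>)"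
  have "ennreal (x powr (-1 - \<beta>) * k x) \<le>
      2 * (ennreal (x powr (-1 - \<beta>)) * ennreal ((1 - c * x) * k x)) + ennreal m * ennreal (k x)" for x
  proof (cases "x \<in> inverse_drift_interval c")
    case False then show ?thesis using k_support by simp
  next
    case True
    then have x: "0 < x" "c * x < 1"
      using drift_nonneg
      by (cases "c = 0"; auto simp: inverse_drift_interval_def field_simps)+
    have "x powr (-1 - \<beta>) * k x \<le>
        2 * (x powr (-1 - \<beta>) * ((1 - c * x) * k x)) + m * k x"
    proof (cases "c * x \<le> 1 / 2")
      case True
      have "x powr (-1 - \<beta>) * k x * 1 \<le> x powr (-1 - \<beta>) * k x * (2 * (1 - c * x))"
        using True k_nonneg[of x] by (intro mult_left_mono) auto
      moreover have "0 \<le> m * k x" using k_nonneg[of x] by (simp add: m_def)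
      ultimately show ?thesis by (simp add: algebra_simps)
    next
      case False
      then have c: "c > 0" using x by (cases "c = 0") (use drift_nonneg in auto)
      have "x powr (-1 - \<beta>) \<le> m" unfolding m_def
        using x c False \<open>0 \<le> \<beta>\<close> by (intro powr_mono2') (auto simp: field_simps)
      then have "x powr (-1 - \<beta>) * k x \<le> m * k x" using k_nonneg by (intro mult_right_mono)
      moreover have "0 \<le> 2 * (x powr (-1 - \<beta>) * ((1 - c * x) * k x))"
        using x k_nonneg[of x] by simp
      ultimately show ?thesis by linarith
    qed
    from ennreal_leI[OF this] show ?thesis
      using x k_nonneg[of x] by (simp add: ennreal_plus ennreal_mult m_def)
  qed
  then have "(\<integral>\<^sup>+x. ennreal (x powr (-1 - \<beta>) * k x) \<partial>lborel) \<le>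
     (\<integral>\<^sup>+x. 2 * (ennreal (x powr (-1 - \<beta>)) * ennreal ((1 - c * x) * k x)) +
        ennreal m * ennreal (k x) \<partial>lborel)"
    by (intro nn_integral_mono)
  also have "\<dots> = 2 * (\<integral>\<^sup>+x. ennreal (x powr (-1 - \<beta>)) * ennreal ((1 - c * x) * k x) \<partial>lborel) +
      ennreal m * (\<integral>\<^sup>+x. ennreal (k x) \<partial>lborel)"
    by (simp add: nn_integral_add nn_integral_cmult)
  also have "\<dots> < \<infinity>"
    using weighted k_integral by (simp add: ennreal_mult_less_top)
  finally show ?thesis .
qed

text \<open>
  The previous lemma gains one order each time, starting from the orders between \<open>-1\<close> and \<open>0\<close>.
  The result goes beyond the order \<open>- \<alpha>\<close> of the limit, which leaves room for the loss in
  the Potter bounds.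
\<close>

lemma inverse_moment_finite:
  assumes "0 \<le> p" "p < \<alpha> + 1"
  shows "(\<integral>\<^sup>+y. ennreal (y powr - p * k y) \<partial>lborel) < \<infinity>"
proof -
  have "(\<integral>\<^sup>+y. ennreal (y powr - p * k y) \<partial>lborel) < \<infinity>"
    if "0 \<le> p" "p < \<alpha> + 1" "p \<le> real n + 1" for n p
    using that
  proof (induction n arbitrary: p)
    case 0
    have "ennreal (y powr - p * k y) \<le> ennreal (k y) + ennreal (k y / y)" for y
    proof (cases "y > 0")
      case True
      have "y powr - p \<le> 1 + 1 / y"
      proof (cases "y \<ge> 1")
        case True
        then have "y powr - p \<le> 1 powr - p" using 0 by (intro powr_mono2') auto
        then have "y powr - p \<le> 1" by simp
        also have "1 \<le> 1 + 1 / y" using True by simp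
        finally show ?thesis .
      next
        case False
        then have "y powr - p \<le> y powr - 1" using 0 \<open>y > 0\<close> by (intro powr_mono') auto
        then show ?thesis using \<open>y > 0\<close> by (simp add: powr_minus_divide)
      qed
      from mult_right_mono[OF this k_nonneg[of y]]
      have "y powr - p * k y \<le> k y + k y / y" by (simp add: algebra_simps)
      then show ?thesis using True k_nonneg[of y]
        by (subst ennreal_plus[symmetric]) (auto simp del: ennreal_plus intro: ennreal_leI)
    qed (simp add: k_zero)
    then have "(\<integral>\<^sup>+y. ennreal (y powr - p * k y) \<partial>lborel) \<le>
        (\<integral>\<^sup>+y. ennreal (k y) + ennreal (k y / y) \<partial>lborel)" by (intro nn_integral_mono)
    also have "\<dots> = (\<integral>\<^sup>+y. ennreal (k y) \<partial>lborel) + (\<integral>\<^sup>+y. ennreal (k y / y) \<partial>lborel)"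
      by (rule nn_integral_add) measurable
    also have "\<dots> < \<infinity>" using k_integral first_inverse_moment by simp
    finally show ?case .
  next
    case (Suc n)
    show ?case
    proof (cases "p \<le> 1")
      case True
      then show ?thesis using Suc by simp
    next
      case False
      then have "(\<integral>\<^sup>+y. ennreal (y powr - (p - 1) * k y) \<partial>lborel) < \<infinity>"
        using Suc.prems by (intro Suc.IH) auto
      from inverse_moment_step[OF _ _ this] show ?thesis using False Suc.prems by simp
    qed
  qed
  from this[of p "nat \<lceil>p\<rceil>"] show ?thesis using assms by (simp add: le_of_int_ceiling add_increasing2)
qed

lemma in_drift_interval:
  assumes "0 < x" "c * x \<le> 1 / 2"
  shows "x \<in> inverse_drift_interval c"
  using assms drift_nonneg
  by (cases "c = 0") (auto simp: inverse_drift_interval_def field_simps)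

section \<open>Behaviour of the density at the origin\<close>

text \<open>
  The difficulty is that near \<open>y = x\<close> the kernel may be unbounded, and nothing is known about \<open>k\<close>
  there except integrability. Dividing the equation by \<open>L x\<close> shows that \<open>k / L\<close> is a
  subsolution for a multiple of the kernel \<open>near (x / y)\<close>, whose row and column integrals are
  at most proportional to the variable that is kept fixed, hence small near the origin. The equation,
  however, links \<open>x\<close> to larger points, so it does not localise to a neighbourhood of \<open>0\<close> by
  itself. A Lipschitz cutoff \<open>w\<close> achieves this: replacing \<open>w x\<close> by \<open>w y\<close> under the integral costs a
  factor \<open>y - x\<close>, which removes the singularity by \<open>singularity_bound\<close>.
\<close>

lemma density_dominated_near_zero:
  obtains \<delta> A where "0 < \<delta>" "0 \<le> A" "\<And>x. 0 < x \<Longrightarrow> x \<le> \<delta> \<Longrightarrow> k x \<le> A * L x"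
proof -
  define p where "p = \<alpha> + 1 / 2"
  have p: "\<alpha> < p" "0 \<le> p" "p < \<alpha> + 1" unfolding p_def using index_nonneg by auto
  define P where "P = enn2real (\<integral>\<^sup>+y. ennreal (y powr - p * k y) \<partial>lborel)"
  have P: "(\<integral>\<^sup>+y. ennreal (y powr - p * k y) \<partial>lborel) = ennreal P" "0 \<le> P"
    unfolding P_def using inverse_moment_finite[OF p(2,3)] by auto
  obtain Cd where Cd: "0 < Cd"
    "\<And>x y. 0 < x \<Longrightarrow> x \<le> y \<Longrightarrow> y \<le> 2 * x \<Longrightarrow> x \<le> 1 / 4 \<Longrightarrow> L y \<le> Cd * L x"
    using doubling by metis
  obtain Cl where Cl: "0 < Cl"
    "\<And>x. 0 < x \<Longrightarrow> x \<le> 1 / 2 \<Longrightarrow> 1 \<le> Cl * (2 * x) powr - p * L x"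
    using power_lower_bound[OF p(1)] by metis
  obtain Cf where Cf: "0 < Cf"
    "\<And>x y. 0 < x \<Longrightarrow> x < 1 \<Longrightarrow> 0 < y \<Longrightarrow> x / y < 1 / 2 \<Longrightarrow> L (x / y) \<le> (Cf * y powr - p + 1) * L x"
    using far_domination[OF p(1)] by metis
  define \<delta> where "\<delta> = min (1 / 4) (min (1 / (2 * (c + 1))) (1 / (8 * Cd * (mass + 1))))"
  have \<delta>: "0 < \<delta>" "\<delta> \<le> 1 / 4" "\<delta> \<le> 1 / (2 * (c + 1))" "\<delta> \<le> 1 / (8 * Cd * (mass + 1))"
    unfolding \<delta>_def using drift_nonneg Cd(1) mass_nonneg by auto
  \<comment> \<open>The three bounds on \<open>\<delta>\<close> keep \<open>2 x\<close> in the range of the kernel estimates, make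
    \<open>1 - c x \<ge> 1/2\<close>, and make the kernel \<open>G\<close> below a contraction.\<close>
  have c\<delta>: "c * x \<le> 1 / 2" if "0 < x" "x < \<delta>" for x
  proof -
    have "(c + 1) * \<delta> \<le> 1 / 2" using \<delta>(3) drift_nonneg by (simp add: field_simps)
    moreover have "c * x \<le> (c + 1) * \<delta>" using that drift_nonneg by (intro mult_mono) auto
    ultimately show ?thesis by simp
  qed
  have m\<delta>: "2 * Cd * (2 * x * mass) \<le> 1 / 2" if "0 < x" "x < \<delta>" for x
  proof -
    have "0 < 8 * Cd * (mass + 1)" using Cd(1) mass_nonneg by simp
    then have "8 * Cd * (mass + 1) * \<delta> \<le> 1"
      using \<delta>(4) by (metis pos_le_divide_eq mult.commute)
    moreover have "8 * Cd * mass * x \<le> 8 * Cd * (mass + 1) * \<delta>"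
      using that Cd(1) mass_nonneg by (intro mult_mono) auto
    ultimately show ?thesis by (simp add: algebra_simps)
  qed
  define w where "w x = max 0 (1 - x / \<delta>)" for x
  have w: "0 \<le> w x" "0 < x \<Longrightarrow> w x \<le> 1" for x
    unfolding w_def using \<delta>(1) by auto
  have w_lipschitz: "w x \<le> w y + (y - x) / \<delta>" if "x \<le> y" for x y
  proof -
    have "1 - x / \<delta> = (1 - y / \<delta>) + (y - x) / \<delta>" using \<delta>(1) by (simp add: field_simps)
    moreover have "0 \<le> (y - x) / \<delta>" using that \<delta>(1) by simp
    ultimately show ?thesis unfolding w_def by auto
  qed
  define f where "f x = w x * k x / L x" for x
  have [measurable]: "w \<in> borel_measurable borel" unfolding w_def by measurable
  have [measurable]: "f \<in> borel_measurable borel" unfolding f_def by measurable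
  have f_nonneg: "0 \<le> f x" for x
    unfolding f_def using w k_nonneg nonneg by (intro divide_nonneg_nonneg mult_nonneg_nonneg)
  have f_pos: "0 < x \<and> x < \<delta>" if "0 < f x" for x
  proof -
    have "k x \<noteq> 0" "w x \<noteq> 0" using that unfolding f_def by auto
    moreover have "x < \<delta>" using \<open>w x \<noteq> 0\<close> \<delta>(1) unfolding w_def by (cases "x < \<delta>") auto
    ultimately show ?thesis using k_zero[of x] by force
  qed
  define B where "B = mass * Cl / \<delta> + Cf"
  have B: "0 \<le> B" unfolding B_def using mass_nonneg Cl(1) \<delta>(1) Cf(1) by auto
  \<comment> \<open>The constant \<open>B\<close> collects the far part and the cost of moving the cutoff.\<close>
  have pointwise: "w x / L x * (L (x / y) * k y) \<le>
      Cd * near (x / y) * f y + (B * (y powr - p * k y) + k y)" if x: "0 < x" "x < \<delta>" for x y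
  proof (cases "0 < y")
    case False
    then show ?thesis using k_zero[of y] by (simp add: f_def)
  next
    case y: True
    have Lx: "0 < L x" using x \<delta>(2) by (intro pos) auto
    have ky: "0 \<le> y powr - p * k y" using k_nonneg[of y] by simp
    have first: "0 \<le> Cd * near (x / y) * f y"
      using Cd(1) near_nonneg f_nonneg by simp
    show ?thesis
    proof (cases "x / y < 1 / 2")
      case True
      have "w x / L x * (L (x / y) * k y) \<le> 1 / L x * (((Cf * y powr - p + 1) * L x) * k y)"
        using w[of x] x Lx k_nonneg[of y] nonneg[of "x / y"] Cf(2)[of x y] True y \<delta>(2)
        by (intro mult_mono divide_right_mono) auto
      also have "\<dots> = Cf * (y powr - p * k y) + k y" using Lx by (simp add: field_simps)
      also have "\<dots> \<le> B * (y powr - p * k y) + k y"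
        using ky mass_nonneg Cl(1) \<delta>(1) unfolding B_def by (intro add_mono mult_right_mono) auto
      finally show ?thesis using first by linarith
    next
      case not_far: False
      have rest: "0 \<le> B * (y powr - p * k y) + k y" using ky B k_nonneg[of y] by simp
      show ?thesis
      proof (cases "L (x / y) = 0")
        case True
        then show ?thesis using first rest by simp
      next
        case False
        have near_L: "near (x / y) = L (x / y)" using not_far by (simp add: near_def)
        have xy: "x < y" "y \<le> 2 * x" using near_nonzero[of x y] near_L False x by auto
        have Ly: "0 < L y" using xy x \<delta>(2) by (intro pos) auto
        have "1 / L x \<le> Cd / L y"
          using Cd(2)[of x y] xy x \<delta>(2) Lx Ly by (simp add: field_simps)
        then have "1 / L x * (w y * (L (x / y) * k y)) \<le> Cd / L y * (w y * (L (x / y) * k y))"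
          using w nonneg k_nonneg by (intro mult_right_mono mult_nonneg_nonneg) auto
        then have part1: "w y / L x * (L (x / y) * k y) \<le> Cd * near (x / y) * f y"
          by (simp add: near_L f_def mult_ac)
        have "(y - x) * L (x / y) = y * (L (x / y) * (1 - x / y))"
          using y by (simp add: field_simps)
        also have "\<dots> \<le> y * mass" using singularity_bound y by (intro mult_left_mono) auto
        also have "\<dots> \<le> mass" using xy x \<delta>(2) mass_nonneg by (simp add: mult_left_le_one_le)
        finally have jump: "(y - x) * L (x / y) \<le> mass" .
        have "1 \<le> Cl * (2 * x) powr - p * L x" using x \<delta>(2) by (intro Cl(2)) auto
        also have "\<dots> \<le> Cl * y powr - p * L x"
          using xy y p Cl(1) Lx by (intro mult_right_mono mult_left_mono powr_mono2') auto
        finally have inv: "1 / L x \<le> Cl * y powr - p" using Lx by (simp add: field_simps)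
        have "(y - x) / \<delta> / L x * (L (x / y) * k y) = (y - x) * L (x / y) * (1 / L x) * (k y / \<delta>)"
          by (simp add: mult_ac)
        also have "\<dots> \<le> mass * (Cl * y powr - p) * (k y / \<delta>)"
          using jump inv Lx xy mass_nonneg k_nonneg[of y] \<delta>(1)
          by (intro mult_right_mono mult_mono) auto
        also have "\<dots> = mass * Cl / \<delta> * (y powr - p * k y)" by simp
        also have "\<dots> \<le> B * (y powr - p * k y)"
          using ky Cf(1) unfolding B_def by (intro mult_right_mono) auto
        finally have part2: "(y - x) / \<delta> / L x * (L (x / y) * k y) \<le> B * (y powr - p * k y)" .
        have "w x / L x * (L (x / y) * k y) \<le> (w y + (y - x) / \<delta>) / L x * (L (x / y) * k y)"
          using w_lipschitz[of x y] xy Lx nonneg k_nonneg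
          by (intro mult_right_mono divide_right_mono mult_nonneg_nonneg) auto
        also have "\<dots> = w y / L x * (L (x / y) * k y) + (y - x) / \<delta> / L x * (L (x / y) * k y)"
          by (simp add: add_divide_distrib distrib_right)
        finally show ?thesis using part1 part2 k_nonneg[of y] by linarith
      qed
    qed
  qed
  define A where "A = 2 * (B * P + 1)"
  have A: "0 \<le> A" unfolding A_def using B P by simp
  define G where "G x y = 2 * Cd * near (x / y)" for x y
  have [measurable]: "(\<lambda>(x, y). G x y) \<in> borel_measurable (borel \<Otimes>\<^sub>M borel)"
    unfolding G_def by measurable
  have bound: "f x \<le> 2 * A" for x
  proof (rule integrable_subsolution_bounded[where f = f and x = x and G = G])
    \<comment> \<open>Integrability of \<open>f\<close>: by Potter, \<open>1 / L\<close> is at most a power whose moment is finite.\<close>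
    have "f x \<le> Cl * (x powr - p * k x)" for x
    proof (cases "0 < f x")
      case False
      moreover have "0 \<le> Cl * (x powr - p * k x)" using Cl(1) k_nonneg by simp
      ultimately show ?thesis by linarith
    next
      case True
      then have x: "0 < x" "x < \<delta>" using f_pos by auto
      have Lx: "0 < L x" using x \<delta>(2) by (intro pos) auto
      have "1 \<le> Cl * (2 * x) powr - p * L x" using x \<delta>(2) by (intro Cl(2)) auto
      also have "\<dots> \<le> Cl * x powr - p * L x"
        using x p Cl(1) Lx by (intro mult_right_mono mult_left_mono powr_mono2') auto
      finally have "1 / L x \<le> Cl * x powr - p" using Lx by (simp add: field_simps)
      then have "w x * k x * (1 / L x) \<le> 1 * k x * (Cl * x powr - p)"
        using w[of x] x k_nonneg[of x] Lx by (intro mult_mono) auto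
      then show ?thesis by (simp add: f_def mult_ac)
    qed
    then have "(\<integral>\<^sup>+x. ennreal (f x) \<partial>lborel) \<le> (\<integral>\<^sup>+x. ennreal Cl * ennreal (x powr - p * k x) \<partial>lborel)"
      using Cl(1) by (intro nn_integral_mono) (simp add: ennreal_mult'[symmetric] ennreal_leI)
    also have "\<dots> = ennreal Cl * ennreal P" by (simp add: nn_integral_cmult P)
    finally show "(\<integral>\<^sup>+x. ennreal (f x) \<partial>lborel) < \<infinity>"
      by (simp add: order.strict_trans1 ennreal_mult_less_top)
  next
    fix x assume "0 < f x"
    then have x: "0 < x" "x < \<delta>" using f_pos by auto
    have Lx: "0 < L x" using x \<delta>(2) by (intro pos) auto
    have "(2 * (1 - c * x)) * f x \<ge> 1 * f x"
      using c\<delta>[OF x] f_nonneg by (intro mult_right_mono) auto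
    then have "ennreal (f x) \<le> ennreal (2 * (w x / L x * ((1 - c * x) * k x)))"
      by (intro ennreal_leI) (simp add: f_def mult_ac)
    also have "\<dots> = ennreal 2 * ennreal (w x / L x * ((1 - c * x) * k x))"
      by (rule ennreal_mult') simp
    also have "\<dots> = 2 * (ennreal (w x / L x) * ennreal ((1 - c * x) * k x))"
      using w[of x] Lx by (subst ennreal_mult') auto
    also have "ennreal (w x / L x) * ennreal ((1 - c * x) * k x) =
        (\<integral>\<^sup>+y. ennreal (w x / L x) * ennreal (L (x / y) * k y) \<partial>lborel)"
      unfolding equation[OF in_drift_interval[OF x(1) c\<delta>[OF x]]]
      by (rule nn_integral_cmult[symmetric]) measurable
    also have "\<dots> \<le> (\<integral>\<^sup>+y. ennreal (Cd * near (x / y) * f y) +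
        (ennreal B * ennreal (y powr - p * k y) + ennreal (k y)) \<partial>lborel)"
    proof (intro nn_integral_mono)
      fix y
      have "ennreal (w x / L x) * ennreal (L (x / y) * k y) = ennreal (w x / L x * (L (x / y) * k y))"
        using w[of x] Lx by (subst ennreal_mult'[symmetric]) auto
      also have "\<dots> \<le> ennreal (Cd * near (x / y) * f y + (B * (y powr - p * k y) + k y))"
        by (intro ennreal_leI pointwise x)
      also have "\<dots> = ennreal (Cd * near (x / y) * f y) +
          (ennreal B * ennreal (y powr - p * k y) + ennreal (k y))"
        using Cd(1) near_nonneg f_nonneg B k_nonneg by (simp add: ennreal_plus ennreal_mult')
      finally show "ennreal (w x / L x) * ennreal (L (x / y) * k y) \<le> \<dots>" .
    qed
    also have "\<dots> = (\<integral>\<^sup>+y. ennreal (Cd * near (x / y) * f y) \<partial>lborel) + (ennreal B * ennreal P + 1)"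
      by (simp add: nn_integral_add nn_integral_cmult P k_integral)
    also have "2 * ((\<integral>\<^sup>+y. ennreal (Cd * near (x / y) * f y) \<partial>lborel) + (ennreal B * ennreal P + 1)) =
        2 * (ennreal B * ennreal P + 1) + (\<integral>\<^sup>+y. 2 * ennreal (Cd * near (x / y) * f y) \<partial>lborel)"
      by (simp add: nn_integral_cmult distrib_left add.commute)
    also have "2 * (ennreal B * ennreal P + 1) = ennreal A"
      unfolding A_def using B P(2) by (simp add: ennreal_mult' ennreal_plus)
    also have "(\<lambda>y. 2 * ennreal (Cd * near (x / y) * f y)) = (\<lambda>y. ennreal (G x y) * ennreal (f y))"
      using Cd(1) near_nonneg f_nonneg by (simp add: G_def ennreal_mult' mult.assoc fun_eq_iff)
    finally show "ennreal (f x) \<le> ennreal A + (\<integral>\<^sup>+y. ennreal (G x y) * ennreal (f y) \<partial>lborel)"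
      by (simp add: mult_left_mono)
  next
    fix x assume "0 < f x"
    then have x: "0 < x" "x < \<delta>" using f_pos by auto
    have "(\<integral>\<^sup>+y. ennreal (G x y) \<partial>lborel) = ennreal (2 * Cd) * (\<integral>\<^sup>+y. ennreal (near (x / y)) \<partial>lborel)"
      unfolding G_def using Cd(1) by (subst nn_integral_cmult[symmetric]) (auto simp: ennreal_mult')
    also have "\<dots> \<le> ennreal (2 * Cd) * ennreal (2 * x * mass)"
      by (intro mult_left_mono near_row_integral x) simp
    also have "\<dots> = ennreal (2 * Cd * (2 * x * mass))"
      using Cd(1) by (subst ennreal_mult') auto
    also have "\<dots> \<le> ennreal (1 / 2)" by (intro ennreal_leI m\<delta> x)
    finally show "(\<integral>\<^sup>+y. ennreal (G x y) \<partial>lborel) \<le> ennreal (1 / 2)" .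
  next
    fix y assume "0 < f y"
    then have y: "0 < y" "y < \<delta>" using f_pos by auto
    have "(\<integral>\<^sup>+x. ennreal (G x y) \<partial>lborel) = ennreal (2 * Cd) * (\<integral>\<^sup>+x. ennreal (near (x / y)) \<partial>lborel)"
      unfolding G_def using Cd(1) by (subst nn_integral_cmult[symmetric]) (auto simp: ennreal_mult')
    also have "\<dots> \<le> ennreal (2 * Cd) * ennreal (y * mass)"
      by (intro mult_left_mono near_column_integral y) simp
    also have "\<dots> = ennreal (2 * Cd * (y * mass))"
      using Cd(1) by (subst ennreal_mult') auto
    also have "\<dots> \<le> ennreal (2 * Cd * (2 * y * mass))"
      using Cd(1) y mass_nonneg by (intro ennreal_leI mult_left_mono mult_right_mono) auto
    also have "\<dots> \<le> ennreal (1 / 2)" by (intro ennreal_leI m\<delta> y)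
    finally show "(\<integral>\<^sup>+x. ennreal (G x y) \<partial>lborel) \<le> ennreal (1 / 2)" .
  qed (use A in \<open>auto\<close>)
  show thesis
  proof (rule that[of "\<delta> / 2" "4 * A"])
    fix x assume x: "0 < x" "x \<le> \<delta> / 2"
    have Lx: "0 < L x" using x \<delta>(2) by (intro pos) auto
    have "1 / 2 \<le> w x" unfolding w_def using x \<delta>(1) by (auto simp: max_def field_simps)
    then have "1 / 2 * (k x / L x) \<le> w x * (k x / L x)"
      using k_nonneg[of x] Lx by (intro mult_right_mono) auto
    also have "\<dots> \<le> 2 * A" using bound[of x] by (simp add: f_def)
    finally show "k x \<le> 4 * A * L x" using Lx by (simp add: field_simps)
  qed (use \<delta> A in auto)
qed

text \<open>
  With \<open>k \<le> A L\<close> the near part is at most a multiple of \<open>L x\<close> times the row integral,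
  which is \<open>O(x)\<close>.
\<close>

lemma near_part_vanishes:
  "((\<lambda>x. (\<integral>y. near (x / y) * k y \<partial>lborel) / L x) \<longlongrightarrow> 0) (at_right 0)"
proof -
  obtain \<delta> A where \<delta>: "0 < \<delta>" "0 \<le> A" "\<And>x. 0 < x \<Longrightarrow> x \<le> \<delta> \<Longrightarrow> k x \<le> A * L x"
    using density_dominated_near_zero by metis
  obtain Cd where Cd: "0 < Cd"
    "\<And>x y. 0 < x \<Longrightarrow> x \<le> y \<Longrightarrow> y \<le> 2 * x \<Longrightarrow> x \<le> 1 / 4 \<Longrightarrow> L y \<le> Cd * L x"
    using doubling by metis
  have bound: "(\<integral>y. near (x / y) * k y \<partial>lborel) / L x \<le> A * Cd * (2 * x * mass)"
    if x: "0 < x" "x < min (\<delta> / 2) (1 / 4)" for x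
  proof -
    have Lx: "0 < L x" using x by (intro pos) auto
    have "near (x / y) * k y \<le> A * Cd * L x * near (x / y)" for y
    proof (cases "near (x / y) = 0")
      case False
      then have xy: "x < y" "y \<le> 2 * x" using near_nonzero x by auto
      have "k y \<le> A * L y" using xy x by (intro \<delta>(3)) auto
      also have "\<dots> \<le> A * (Cd * L x)" using xy x by (intro mult_left_mono Cd(2) \<delta>(2)) auto
      finally have "near (x / y) * k y \<le> near (x / y) * (A * (Cd * L x))"
        using near_nonneg by (intro mult_left_mono)
      then show ?thesis by (simp add: mult_ac)
    qed simp
    then have "(\<integral>\<^sup>+y. ennreal (near (x / y) * k y) \<partial>lborel) \<le>
        (\<integral>\<^sup>+y. ennreal (A * Cd * L x) * ennreal (near (x / y)) \<partial>lborel)"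
      using \<delta>(2) Cd(1) Lx
      by (intro nn_integral_mono) (simp add: ennreal_mult'[symmetric] ennreal_leI)
    also have "\<dots> = ennreal (A * Cd * L x) * (\<integral>\<^sup>+y. ennreal (near (x / y)) \<partial>lborel)"
      by (rule nn_integral_cmult) measurable
    also have "\<dots> \<le> ennreal (A * Cd * L x) * ennreal (2 * x * mass)"
      by (intro mult_left_mono near_row_integral x) simp
    also have "\<dots> = ennreal (A * Cd * L x * (2 * x * mass))"
      using \<delta>(2) Cd(1) Lx by (subst ennreal_mult') auto
    finally have "enn2real (\<integral>\<^sup>+y. ennreal (near (x / y) * k y) \<partial>lborel) \<le> A * Cd * L x * (2 * x * mass)"
      using \<delta>(2) Cd(1) Lx x mass_nonneg by (intro enn2real_leI) auto
    moreover have "(\<integral>y. near (x / y) * k y \<partial>lborel) =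
        enn2real (\<integral>\<^sup>+y. ennreal (near (x / y) * k y) \<partial>lborel)"
      using near_nonneg k_nonneg by (intro integral_eq_nn_integral) auto
    ultimately show ?thesis using Lx by (simp add: field_simps)
  qed
  show ?thesis
  proof (rule tendsto_sandwich[where f = "\<lambda>_. 0"])
    have "((\<lambda>x. A * Cd * (2 * x * mass)) \<longlongrightarrow> A * Cd * (2 * 0 * mass)) (at_right 0)"
      by (intro tendsto_intros)
    then show "((\<lambda>x. A * Cd * (2 * x * mass)) \<longlongrightarrow> 0) (at_right 0)" by simp
    show "\<forall>\<^sub>F x in at_right 0. 0 \<le> (\<integral>y. near (x / y) * k y \<partial>lborel) / L x"
      using nonneg near_nonneg k_nonneg
      by (intro always_eventually allI divide_nonneg_nonneg integral_nonneg_AE) auto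
    show "\<forall>\<^sub>F x in at_right 0. (\<integral>y. near (x / y) * k y \<partial>lborel) / L x \<le> A * Cd * (2 * x * mass)"
      unfolding eventually_at_right_field using bound \<delta>(1)
      by (intro exI[of _ "min (\<delta> / 2) (1 / 4)"]) auto
  qed simp
qed

text \<open>
  Dominated convergence: for fixed \<open>y\<close> the quotient \<open>L (x / y) / L x\<close> tends to \<open>y powr - \<alpha>\<close>, and
  \<open>far_domination\<close> bounds it by \<open>C * y powr - p + 1\<close> with \<open>p\<close> slightly above \<open>\<alpha>\<close>, whose
  integral against \<open>k\<close> is finite.
\<close>

lemma far_part_limit:
  "((\<lambda>x. (\<integral>y. far (x / y) * k y \<partial>lborel) / L x) \<longlongrightarrow> (\<integral>y. y powr - \<alpha> * k y \<partial>lborel)) (at_right 0)"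
  unfolding tendsto_at_iff_sequentially
proof (intro allI impI)
  fix X :: "nat \<Rightarrow> real" assume "\<forall>i. X i \<in> {0<..} - {0}" and X_lim: "X \<longlonglongrightarrow> 0"
  then have X_pos: "0 < X i" for i by simp
  have X_right: "filterlim X (at_right 0) sequentially"
    using X_lim X_pos by (auto simp: filterlim_at less_imp_neq[OF X_pos, symmetric])
  define p where "p = \<alpha> + 1 / 2"
  have p: "\<alpha> < p" "0 \<le> p" "p < \<alpha> + 1" unfolding p_def using index_nonneg by auto
  obtain C where C: "0 < C"
    "\<And>x y. 0 < x \<Longrightarrow> x < 1 \<Longrightarrow> 0 < y \<Longrightarrow> x / y < 1 / 2 \<Longrightarrow> L (x / y) \<le> (C * y powr - p + 1) * L x"
    using far_domination[OF p(1)] by metis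
  \<comment> \<open>The last factor makes the domination valid for all indices, as the sequence may start
    far from \<open>0\<close>.\<close>
  define D where "D x y = far (x / y) * k y / L x * of_bool (x < 1)" for x y
  define g where "g y = C * (y powr - p * k y) + k y" for y
  have [measurable]: "D x \<in> borel_measurable borel" for x unfolding D_def by measurable
  have dom: "norm (D x y) \<le> g y" if "0 < x" for x y
  proof (cases "x < 1 \<and> 0 < y \<and> x / y < 1 / 2")
    case False
    have "0 \<le> g y" unfolding g_def using C(1) k_nonneg by simp
    moreover have "D x y = 0" using False k_zero[of y] by (cases "0 < y") (auto simp: D_def far_def)
    ultimately show ?thesis by simp
  next
    case True
    then have Lx: "0 < L x" using that by (intro pos) auto
    have "L (x / y) * k y / L x \<le> (C * y powr - p + 1) * L x * k y / L x"
      using True that Lx k_nonneg[of y] by (intro divide_right_mono mult_right_mono C(2)) auto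
    also have "\<dots> = g y" using Lx by (simp add: g_def field_simps)
    finally have "L (x / y) * k y / L x \<le> g y" .
    moreover have "0 \<le> L (x / y) * k y / L x" using Lx nonneg[of "x / y"] k_nonneg[of y] by simp
    moreover have "D x y = L (x / y) * k y / L x" using True unfolding D_def far_def by simp
    ultimately show ?thesis by simp
  qed
  have "integrable lborel (\<lambda>y. y powr - p * k y)"
    using inverse_moment_finite[OF p(2,3)] k_nonneg by (intro integrableI_nonneg) auto
  moreover have "integrable lborel k"
    using k_integral k_nonneg by (intro integrableI_nonneg) auto
  ultimately have g: "integrable lborel g" unfolding g_def by auto
  have "(\<lambda>i. \<integral>y. D (X i) y \<partial>lborel) \<longlonglongrightarrow> (\<integral>y. y powr - \<alpha> * k y \<partial>lborel)"
  proof (rule integral_dominated_convergence[OF _ _ g])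
    show "AE y in lborel. (\<lambda>i. D (X i) y) \<longlonglongrightarrow> y powr - \<alpha> * k y"
    proof (intro AE_I2)
      fix y :: real
      show "(\<lambda>i. D (X i) y) \<longlonglongrightarrow> y powr - \<alpha> * k y"
      proof (cases "0 < y")
        case False then show ?thesis by (simp add: k_zero D_def)
      next
        case True
        have "((\<lambda>x. L (1 / y * x) / L x * k y) \<longlongrightarrow> (1 / y) powr \<alpha> * k y) (at_right 0)"
          using True by (intro tendsto_intros regular_variation) auto
        moreover have "\<forall>\<^sub>F x in at_right 0. L (1 / y * x) / L x * k y = D x y"
          unfolding eventually_at_right_field using True
          by (intro exI[of _ "min 1 (y / 2)"]) (auto simp: D_def far_def field_simps)
        ultimately have "((\<lambda>x. D x y) \<longlongrightarrow> (1 / y) powr \<alpha> * k y) (at_right 0)"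
          by (rule Lim_transform_eventually)
        then have "((\<lambda>x. D x y) \<longlongrightarrow> y powr - \<alpha> * k y) (at_right 0)"
          using True by (simp add: powr_divide powr_minus_divide)
        then show ?thesis using X_right by (rule filterlim_compose)
      qed
    qed
  qed (use dom X_pos in auto)
  moreover have "\<forall>\<^sub>F i in sequentially.
      (\<integral>y. D (X i) y \<partial>lborel) = (\<integral>y. far (X i / y) * k y \<partial>lborel) / L (X i)"
    using order_tendstoD(2)[OF X_lim zero_less_one] by eventually_elim (simp add: D_def)
  ultimately have "(\<lambda>i. (\<integral>y. far (X i / y) * k y \<partial>lborel) / L (X i)) \<longlonglongrightarrow>
      (\<integral>y. y powr - \<alpha> * k y \<partial>lborel)"
    by (rule Lim_transform_eventually)
  then show "((\<lambda>x. (\<integral>y. far (x / y) * k y \<partial>lborel) / L x) \<circ> X) \<longlonglongrightarrow>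
      (\<integral>y. y powr - \<alpha> * k y \<partial>lborel)" by (simp add: comp_def)
qed

lemma density_asymptotics:
  "((\<lambda>x. k x / L x) \<longlongrightarrow> (\<integral>y. y powr - \<alpha> * k y \<partial>lborel)) (at_right 0)"
proof -
  define N F where "N x = (\<integral>y. near (x / y) * k y \<partial>lborel)"
    and "F x = (\<integral>y. far (x / y) * k y \<partial>lborel)" for x
  have split: "(N x / L x + F x / L x) / (1 - c * x) = k x / L x" if x: "0 < x" "c * x \<le> 1 / 2" for x
  proof -
    have fin: "(\<integral>\<^sup>+y. ennreal (L (x / y) * k y) \<partial>lborel) < \<infinity>"
      unfolding equation[OF in_drift_interval[OF x], symmetric] by simp
    have le: "near t \<le> L t" "far t \<le> L t" for t
      using nonneg by (auto simp: near_def far_def)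
    have L_int: "integrable lborel (\<lambda>y. L (x / y) * k y)"
      using fin nonneg k_nonneg by (intro integrableI_nonneg) auto
    have near_int: "integrable lborel (\<lambda>y. near (x / y) * k y)"
      by (rule Bochner_Integration.integrable_bound[OF L_int])
         (auto simp: abs_mult near_nonneg nonneg k_nonneg le intro!: mult_right_mono)
    have far_int: "integrable lborel (\<lambda>y. far (x / y) * k y)"
      by (rule Bochner_Integration.integrable_bound[OF L_int])
         (auto simp: abs_mult far_nonneg nonneg k_nonneg le intro!: mult_right_mono)
    have "(1 - c * x) * k x = (\<integral>y. L (x / y) * k y \<partial>lborel)"
      using equation[OF in_drift_interval[OF x], symmetric] x nonneg k_nonneg
      by (subst integral_eq_nn_integral) auto
    also have "\<dots> = (\<integral>y. near (x / y) * k y + far (x / y) * k y \<partial>lborel)"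
      by (simp add: near_plus_far[symmetric] distrib_right)
    also have "\<dots> = N x + F x" unfolding N_def F_def using near_int far_int by simp
    finally have "N x / L x + F x / L x = (1 - c * x) * (k x / L x)"
      by (simp add: add_divide_distrib[symmetric])
    then show ?thesis using x by simp
  qed
  have "((\<lambda>x. (N x / L x + F x / L x) / (1 - c * x)) \<longlongrightarrow>
      (0 + (\<integral>y. y powr - \<alpha> * k y \<partial>lborel)) / (1 - c * 0)) (at_right 0)"
    unfolding N_def F_def
    by (intro tendsto_intros near_part_vanishes far_part_limit) auto
  moreover have "\<forall>\<^sub>F x in at_right 0. (N x / L x + F x / L x) / (1 - c * x) = k x / L x"
    unfolding eventually_at_right_field
  proof (intro exI[of _ "1 / (2 * (c + 1))"] conjI allI impI)
    fix x assume x: "0 < x" "x < 1 / (2 * (c + 1))"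
    have "c * x \<le> (c + 1) * x" using x by (simp add: distrib_right)
    also have "\<dots> \<le> 1 / 2" using x drift_nonneg by (simp add: field_simps)
    finally show "(N x / L x + F x / L x) / (1 - c * x) = k x / L x" using x by (intro split) auto
  qed (use drift_nonneg in auto)
  ultimately have "((\<lambda>x. k x / L x) \<longlongrightarrow>
      (0 + (\<integral>y. y powr - \<alpha> * k y \<partial>lborel)) / (1 - c * 0)) (at_right 0)"
    by (rule Lim_transform_eventually)
  then show ?thesis by simp
qed

lemma inverse_moment_pos: "0 < (\<integral>y. y powr - \<alpha> * k y \<partial>lborel)"
proof -
  have int: "integrable lborel (\<lambda>y. y powr - \<alpha> * k y)"
    using inverse_moment_finite[of \<alpha>] index_nonneg k_nonneg by (intro integrableI_nonneg) auto
  have "\<not> (AE y in lborel. y powr - \<alpha> * k y = 0)"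
  proof
    assume "AE y in lborel. y powr - \<alpha> * k y = 0"
    then have "AE y in lborel. k y = 0"
      by eventually_elim (metis k_zero linorder_not_le mult_eq_0_iff powr_gt_zero less_irrefl)
    then have "(\<integral>\<^sup>+x. ennreal (k x) \<partial>lborel) = (\<integral>\<^sup>+(x::real). 0 \<partial>lborel)"
      by (intro nn_integral_cong_AE) (auto elim: eventually_mono)
    then show False using k_integral by simp
  qed
  then have "(\<integral>y. y powr - \<alpha> * k y \<partial>lborel) \<noteq> 0"
    using integral_nonneg_eq_0_iff_AE[OF int] k_nonneg by auto
  moreover have "0 \<le> (\<integral>y. y powr - \<alpha> * k y \<partial>lborel)"
    using k_nonneg by (intro integral_nonneg_AE) auto
  ultimately show ?thesis by simp
qed

end

section \<open>From the Levy measure and the laws to the integral equation\<close>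

text \<open>
  Both sides are the integral of \<open>k\<close> against \<open>dx / x\<close>, which is the Haar measure of the
  multiplicative half-line and hence invariant under inversion. In this form, a finite mass of
  \<open>k\<^sub>\<psi>\<close> says that the inverse moment of order one is finite.
\<close>

lemma inverse_moment_finite_of_inversion:
  fixes k :: "real \<Rightarrow> real"
  assumes [measurable]: "k \<in> borel_measurable borel" and nonneg: "\<And>x. 0 \<le> k x"
    and fin: "(\<integral>\<^sup>+x. ennreal (indicator {0<..} x * (1 / x * k (1 / x))) \<partial>lborel) < \<infinity>"
  shows "(\<integral>\<^sup>+x. ennreal (indicator {0<..} x * (k x / x)) \<partial>lborel) < \<infinity>"
proof -
  define F where "F x = k x / x" for x
  have [measurable]: "F \<in> borel_measurable borel" unfolding F_def by measurable
  have image: "(\<lambda>x. 1 / x) ` {0<..} = {0::real<..}"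
  proof (intro equalityI subsetI)
    fix x :: real assume "x \<in> {0<..}"
    then show "x \<in> (\<lambda>x. 1 / x) ` {0<..}" by (intro image_eqI[of _ _ "1 / x"]) auto
  qed auto
  have inv: "\<bar>- (1 / x\<^sup>2)\<bar> * F (1 / x) = 1 / x * k (1 / x)" if "x \<in> {0<..}" for x
    using that by (simp add: F_def power2_eq_square field_simps)
  have "integrable lborel (\<lambda>x. indicator {0<..} x * (1 / x * k (1 / x)))"
    using fin nonneg by (intro integrableI_nonneg) (auto simp: indicator_def)
  then have "set_integrable lborel {0<..} (\<lambda>x. 1 / x * k (1 / x))"
    by (simp add: set_integrable_def)
  then have "set_integrable lborel {0<..} (\<lambda>x. \<bar>- (1 / x\<^sup>2)\<bar> * F (1 / x))"
    using inv by (subst set_integrable_cong[OF refl refl]) auto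
  then have "(\<lambda>x. \<bar>- (1 / x\<^sup>2)\<bar> * F (1 / x)) absolutely_integrable_on {0<..}"
    by (simp add: set_integrable_def integrable_completion)
  then have "F absolutely_integrable_on (\<lambda>x. 1 / x) ` {0<..}"
    by (subst absolutely_integrable_change_of_variables_1'[where h = "\<lambda>x. - (1 / x\<^sup>2)"])
       (auto intro!: derivative_eq_intros simp: inj_on_def power2_eq_square)
  then have "integrable lborel (\<lambda>x. indicator {0<..} x * F x)"
    by (simp add: image set_integrable_def integrable_completion)
  then have "(\<integral>\<^sup>+x. ennreal (norm (indicator {0<..} x * F x)) \<partial>lborel) < \<infinity>"
    by (simp only: integrable_iff_bounded)
  also have "(\<integral>\<^sup>+x. ennreal (norm (indicator {0<..} x * F x)) \<partial>lborel) =
      (\<integral>\<^sup>+x. ennreal (indicator {0<..} x * (k x / x)) \<partial>lborel)"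
    using nonneg by (intro nn_integral_cong) (auto simp: indicator_def F_def)
  finally show ?thesis .
qed

lemma
  assumes "subordinator_levy_measure \<nu>"
  shows levy_measure_sigma_finite: "sigma_finite_measure \<nu>"
    and levy_measure_tail_finite: "0 < x \<Longrightarrow> emeasure \<nu> {x<..} < \<infinity>"
proof -
  have sets [measurable_cong]: "sets \<nu> = sets borel" and zero: "emeasure \<nu> {..0} = 0"
    and fin: "(\<integral>\<^sup>+x\<in>{0<..}. ennreal (min 1 x) \<partial>\<nu>) < \<infinity>"
    using assms by (auto simp: subordinator_levy_measure_def)
  have tail: "emeasure \<nu> {x<..} < \<infinity>" if "0 < x" for x
  proof -
    have "ennreal (min 1 x) * emeasure \<nu> {x<..} = (\<integral>\<^sup>+y. ennreal (min 1 x) * indicator {x<..} y \<partial>\<nu>)"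
      by (simp add: nn_integral_cmult sets)
    also have "\<dots> \<le> (\<integral>\<^sup>+x\<in>{0<..}. ennreal (min 1 x) \<partial>\<nu>)"
      using that by (intro nn_integral_mono) (auto simp: indicator_def intro!: ennreal_leI)
    finally have "ennreal (min 1 x) * emeasure \<nu> {x<..} < \<infinity>" using fin by (rule order.strict_trans1)
    then show ?thesis using that by (auto simp: ennreal_mult_less_top)
  qed
  then show "0 < x \<Longrightarrow> emeasure \<nu> {x<..} < \<infinity>" by simp
  show "sigma_finite_measure \<nu>"
  proof
    show "\<exists>A. countable A \<and> A \<subseteq> sets \<nu> \<and> \<Union> A = space \<nu> \<and> (\<forall>a\<in>A. emeasure \<nu> a \<noteq> \<infinity>)"
    proof (intro exI[of _ "insert {..0} (range (\<lambda>n. {1 / real (Suc n)<..}))"] conjI ballI)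
      have "x \<le> 0 \<or> (\<exists>n. 1 / real (Suc n) < x)" for x :: real
      proof (cases "0 < x")
        case True
        from reals_Archimedean[OF this] show ?thesis by (simp add: inverse_eq_divide)
      qed simp
      then show "\<Union> (insert {..0} (range (\<lambda>n. {1 / real (Suc n)<..}))) = space \<nu>"
        using sets_eq_imp_space_eq[OF sets] by auto
      fix a assume "a \<in> insert {..0} (range (\<lambda>n. {1 / real (Suc n)<..}))"
      then consider "a = {..0}" | n where "a = {1 / real (Suc n)<..}" by blast
      then show "emeasure \<nu> a \<noteq> \<infinity>"
      proof cases
        case 1
        then show ?thesis using zero by simp
      next
        case 2
        have "emeasure \<nu> a < \<infinity>" unfolding 2 by (rule tail) simp
        then show ?thesis by simp
      qed
    qed (auto simp: sets)
  qed
qed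

text \<open>
  In the variable \<open>t = x / y\<close> the kernel \<open>levy_tail \<nu> (ln (y / x))\<close> of the integral equation becomes a
  function of a quotient; the value \<open>0\<close> off the unit interval replaces the restriction
  of the integral to \<open>y > x\<close>.
\<close>

definition log_tail :: "real measure \<Rightarrow> real \<Rightarrow> real" where
  "log_tail \<nu> t = (if 0 < t \<and> t < 1 then levy_tail \<nu> (- ln t) else 0)"

text \<open>
  By Fubini the integral is that of the length of \<open>{t. exp (- x) < t < 1}\<close> against \<open>\<nu>\<close>, and
  \<open>1 - exp (- x) \<le> min 1 x\<close>. So the singularity of the kernel at \<open>1\<close>, which comes from the small
  jumps, is always integrable.
\<close>

lemma log_tail_integral_finite:
  assumes \<nu>: "subordinator_levy_measure \<nu>"
  shows "(\<integral>\<^sup>+t. ennreal (log_tail \<nu> t) \<partial>lborel) < \<infinity>"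
proof -
  have sets [measurable_cong]: "sets \<nu> = sets borel"
    and fin: "(\<integral>\<^sup>+x\<in>{0<..}. ennreal (min 1 x) \<partial>\<nu>) < \<infinity>"
    using \<nu> by (auto simp: subordinator_levy_measure_def)
  interpret sigma_finite_measure \<nu>
    by (rule levy_measure_sigma_finite) fact
  interpret pair_sigma_finite \<nu> lborel
    by unfold_locales
  define S :: "real \<Rightarrow> real \<Rightarrow> ennreal"
    where "S x t = indicator {(x, t). 0 < t \<and> t < 1 \<and> - ln t < x} (x, t)" for x t
  have [measurable]: "(\<lambda>(x, t). S x t) \<in> borel_measurable (\<nu> \<Otimes>\<^sub>M lborel)"
    unfolding S_def by measurable
  have "(\<integral>\<^sup>+t. ennreal (log_tail \<nu> t) \<partial>lborel) \<le> (\<integral>\<^sup>+t. (\<integral>\<^sup>+x. S x t \<partial>\<nu>) \<partial>lborel)"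
  proof (intro nn_integral_mono)
    fix t
    show "ennreal (log_tail \<nu> t) \<le> (\<integral>\<^sup>+x. S x t \<partial>\<nu>)"
    proof (cases "0 < t \<and> t < 1")
      case True
      then have "(\<integral>\<^sup>+x. S x t \<partial>\<nu>) = (\<integral>\<^sup>+x. indicator {- ln t<..} x \<partial>\<nu>)"
        by (intro nn_integral_cong) (auto simp: S_def indicator_def)
      also have "\<dots> = emeasure \<nu> {- ln t<..}" by (simp add: sets)
      finally have S_eq: "(\<integral>\<^sup>+x. S x t \<partial>\<nu>) = emeasure \<nu> {- ln t<..}" .
      have "emeasure \<nu> {- ln t<..} < \<infinity>"
        using True by (intro levy_measure_tail_finite[OF \<nu>]) simp
      then show ?thesis using True S_eq
        by (simp add: log_tail_def levy_tail_def emeasure_eq_ennreal_measure)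
    next
      case False
      then have "log_tail \<nu> t = 0" unfolding log_tail_def by (simp only: if_False)
      then show ?thesis by simp
    qed
  qed
  also have "\<dots> = (\<integral>\<^sup>+x. (\<integral>\<^sup>+t. S x t \<partial>lborel) \<partial>\<nu>)"
    by (rule Fubini') measurable
  also have "\<dots> \<le> (\<integral>\<^sup>+x\<in>{0<..}. ennreal (min 1 x) \<partial>\<nu>)"
  proof (intro nn_integral_mono)
    fix x
    show "(\<integral>\<^sup>+t. S x t \<partial>lborel) \<le> ennreal (min 1 x) * indicator {0<..} x"
    proof (cases "0 < x")
      case True
      have "(\<integral>\<^sup>+t. S x t \<partial>lborel) \<le> (\<integral>\<^sup>+t. indicator {exp (- x)..1} t \<partial>lborel)"
      proof (intro nn_integral_mono)
        fix t
        have "exp (- x) < t" if "0 < t" "- ln t < x"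
        proof -
          have "exp (- x) < exp (ln t)" using that(2) by (subst exp_less_cancel_iff) simp
          then show ?thesis using that(1) by simp
        qed
        then show "S x t \<le> indicator {exp (- x)..1} t"
          by (auto simp: S_def indicator_def)
      qed
      also have "\<dots> = ennreal (1 - exp (- x))" using True by simp
      also have "\<dots> \<le> ennreal (min 1 x)"
        using exp_ge_add_one_self[of "- x"] by (intro ennreal_leI) auto
      finally show ?thesis using True by simp
    next
      case False
      have "S x t = 0" for t
      proof (cases "0 < t \<and> t < 1")
        case True
        then have "ln t < 0" by simp
        then show ?thesis using False by (simp add: S_def indicator_def)
      qed (auto simp: S_def indicator_def)
      then show ?thesis by simp
    qed
  qed
  finally show ?thesis using fin by (rule order.strict_trans1)
qed

lemma log_tail_regularly_varying_kernel:
  assumes \<nu>: "subordinator_levy_measure \<nu>" and "0 \<le> \<alpha>"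
    and lim: "\<And>y. ((\<lambda>x. levy_tail \<nu> (x + y) / levy_tail \<nu> x) \<longlongrightarrow> exp (- \<alpha> * y)) at_top"
  shows "regularly_varying_kernel (log_tail \<nu>) \<alpha>"
proof
  have sets [measurable_cong]: "sets \<nu> = sets borel"
    using \<nu> by (simp add: subordinator_levy_measure_def)
  note tail_fin = levy_measure_tail_finite[OF \<nu>]
  have antimono: "levy_tail \<nu> y \<le> levy_tail \<nu> x" if "0 < x" "x \<le> y" for x y
    unfolding levy_tail_def using that tail_fin[of x]
    by (intro measure_mono_fmeasurable fmeasurableI) (auto simp: sets)
  \<comment> \<open>The limit for \<open>y = 0\<close> would be that of \<open>0 / 0 = 0\<close> if the tail vanished far out.\<close>
  have pos: "0 < levy_tail \<nu> x" if "0 < x" for x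
  proof -
    have "((\<lambda>x. levy_tail \<nu> (x + 0) / levy_tail \<nu> x) \<longlongrightarrow> 1) at_top"
      using lim[of 0] by simp
    then have "\<forall>\<^sub>F z in at_top. 1 / 2 < levy_tail \<nu> (z + 0) / levy_tail \<nu> z"
      by (rule order_tendstoD) simp
    then have "\<forall>\<^sub>F z in at_top. 1 / 2 < levy_tail \<nu> (z + 0) / levy_tail \<nu> z \<and> x \<le> z"
      using eventually_ge_at_top by (rule eventually_conj)
    then obtain z where z: "1 / 2 < levy_tail \<nu> (z + 0) / levy_tail \<nu> z" "x \<le> z"
      using eventually_happens'[OF trivial_limit_at_top_linorder] by blast
    then have "levy_tail \<nu> z \<noteq> 0" by auto
    then have "0 < levy_tail \<nu> z" by (simp add: levy_tail_def zero_less_measure_iff)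
    then show ?thesis using antimono[OF that z(2)] by linarith
  qed
  show "log_tail \<nu> t = 0" if "t \<notin> {0<..<1}" for t
    using that by (auto simp: log_tail_def)
  show "0 < log_tail \<nu> t" if "0 < t" "t < 1" for t
    using that pos[of "- ln t"] by (simp add: log_tail_def)
  show "log_tail \<nu> s \<le> log_tail \<nu> t" if "0 < s" "s \<le> t" "t < 1" for s t
    using that antimono[of "- ln t" "- ln s"] by (simp add: log_tail_def)
  show "(\<integral>\<^sup>+t. ennreal (log_tail \<nu> t) \<partial>lborel) < \<infinity>"
    by (rule log_tail_integral_finite) fact
  show "((\<lambda>x. log_tail \<nu> (t * x) / log_tail \<nu> x) \<longlongrightarrow> t powr \<alpha>) (at_right 0)" if "0 < t" for t
  proof -
    have "filterlim (\<lambda>x::real. - ln x) at_top (at_right 0)"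
      by (intro filterlim_compose[OF filterlim_uminus_at_top_at_bot ln_at_0])
    from filterlim_compose[OF lim[of "- ln t"] this]
    have "((\<lambda>x. levy_tail \<nu> (- ln x + - ln t) / levy_tail \<nu> (- ln x)) \<longlongrightarrow> exp (- \<alpha> * (- ln t)))
      (at_right 0)" .
    moreover have "exp (- \<alpha> * (- ln t)) = t powr \<alpha>" using that by (simp add: powr_def)
    moreover have "\<forall>\<^sub>F x in at_right 0.
        levy_tail \<nu> (- ln x + - ln t) / levy_tail \<nu> (- ln x) = log_tail \<nu> (t * x) / log_tail \<nu> x"
      unfolding eventually_at_right_field
    proof (intro exI[of _ "min 1 (1 / t)"] conjI allI impI)
      fix x assume x: "0 < x" "x < min 1 (1 / t)"
      then have "t * x < 1" using that by (simp add: field_simps)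
      then show "levy_tail \<nu> (- ln x + - ln t) / levy_tail \<nu> (- ln x) =
          log_tail \<nu> (t * x) / log_tail \<nu> x"
        using x that by (simp add: log_tail_def ln_mult add.commute)
    qed (use that in auto)
    ultimately show ?thesis by (simp only: Lim_transform_eventually)
  qed
qed fact

lemma has_pdf_nn_integral:
  assumes "prob_space M" "has_pdf M Z f"
  shows "f \<in> borel_measurable borel" "(\<integral>\<^sup>+x. ennreal (f x) \<partial>lborel) = 1"
proof -
  interpret prob_space M by fact
  have f: "\<And>x. 0 \<le> f x" "distributed M lborel Z (\<lambda>x. ennreal (f x))"
    using assms(2) by (auto simp: has_pdf_def)
  show "f \<in> borel_measurable borel"
    using distributed_real_measurable[of lborel f M Z] f by simp
  show "(\<integral>\<^sup>+x. ennreal (f x) \<partial>lborel) = 1"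
    using distributed_nn_integral[OF f(2), of "\<lambda>_. 1"] by (simp add: emeasure_space_1)
qed

lemma nonneg_pdf_not_null:
  assumes "prob_space M" "has_pdf M Z f" "\<And>\<omega>. 0 \<le> Z \<omega>"
  shows "\<exists>x>0. f x \<noteq> 0"
proof (rule ccontr)
  assume "\<not> ?thesis"
  then have zero: "f x = 0" if "0 < x" for x using that by blast
  interpret prob_space M by fact
  have Z: "distributed M lborel Z (\<lambda>x. ennreal (f x))"
    using assms(2) by (auto simp: has_pdf_def)
  have "1 = emeasure M (Z -` {0..} \<inter> space M)"
    using assms(3) by (simp add: vimage_def emeasure_space_1)
  also have "\<dots> = (\<integral>\<^sup>+x. ennreal (f x) * indicator {0..} x \<partial>lborel)"
    by (rule distributed_emeasure[OF Z]) simp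
  also have "\<dots> = (\<integral>\<^sup>+(x::real). 0 \<partial>lborel)"
  proof (rule nn_integral_cong_AE)
    show "AE x in lborel. ennreal (f x) * indicator {0..} x = 0"
      using AE_lborel_singleton[of 0]
      by eventually_elim (use zero in \<open>auto simp: indicator_def\<close>)
  qed
  finally show False by simp
qed

lemma exponential_functional_nonneg: "0 \<le> exponential_functional X \<omega>"
  unfolding exponential_functional_def set_lebesgue_integral_def
  by (intro integral_nonneg_AE) auto

section \<open>The tail of the exponential functional\<close>

theorem corollary2p7:
  fixes M :: "'a measure" and \<zeta> :: "real \<Rightarrow> 'a \<Rightarrow> real"
    and N :: "'b measure" and Y :: "real \<Rightarrow> 'b \<Rightarrow> real"
    and c \<alpha> :: real and \<nu> U :: "real measure"
    and k k\<^sub>\<psi> :: "real \<Rightarrow> real"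
  assumes "subordinator M \<zeta>"
    and "has_drift_and_levy_measure M \<zeta> c \<nu>"
    and "integrable M (\<zeta> 1)"
    and "0 \<le> \<alpha>"
    and "\<And>y. ((\<lambda>x. levy_tail \<nu> (x + y) / levy_tail \<nu> x) \<longlongrightarrow> exp (- \<alpha> * y)) at_top"
    and "renewal_measure M \<zeta> U"
    and "has_nonincreasing_convex_density U"
    and "spectrally_negative_levy_process N Y"
    and "drifts_to_infinity N Y"
    and "\<And>l. 0 < l \<Longrightarrow> integrable N (\<lambda>\<omega>. exp (l * Y 1 \<omega>)) \<and>
           ln (\<integral>\<omega>. exp (l * Y 1 \<omega>) \<partial>N) = l\<^sup>2 / laplace_exponent M \<zeta> l"
    and "subordinator_functional_density M \<zeta> c \<nu> k"
    and "has_pdf N (exponential_functional Y) k\<^sub>\<psi>"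
    and "\<And>x. 0 < x \<Longrightarrow> k\<^sub>\<psi> x = q_star c \<nu> * (1 / x) * k (1 / x)"
  shows "((\<lambda>x. k\<^sub>\<psi> x /
            (q_star c \<nu> * (\<integral>\<omega>. exponential_functional \<zeta> \<omega> powr (- \<alpha>) \<partial>M) *
             (1 / x) * levy_tail \<nu> (ln x))) \<longlongrightarrow> 1) at_top"
proof -
  interpret S: subordinator M \<zeta> by fact
  interpret Yp: spectrally_negative_levy_process N Y by fact
  have "prob_space M" "prob_space N" by unfold_locales
  have c: "0 \<le> c" and \<nu>: "subordinator_levy_measure \<nu>"
    using assms(2) by (auto simp: has_drift_and_levy_measure_def)
  have k_pdf: "has_pdf M (exponential_functional \<zeta>) k"
    and k_support: "\<And>x. x \<notin> inverse_drift_interval c \<Longrightarrow> k x = 0"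
    and k_eq: "\<And>x. x \<in> inverse_drift_interval c \<Longrightarrow> ennreal ((1 - c * x) * k x) =
      (\<integral>\<^sup>+y\<in>{x<..}. ennreal (levy_tail \<nu> (ln (y / x)) * k y) \<partial>lborel)"
    using assms(11) by (auto simp: subordinator_functional_density_def)
  have k_nonneg: "\<And>x. 0 \<le> k x"
    and k_dist: "distributed M lborel (exponential_functional \<zeta>) (\<lambda>x. ennreal (k x))"
    using k_pdf by (auto simp: has_pdf_def)
  note k_meas [measurable] = has_pdf_nn_integral(1)[OF \<open>prob_space M\<close> k_pdf]
  define L where "L = log_tail \<nu>"
  define q where "q = q_star c \<nu>"
  have k\<psi>: "k\<^sub>\<psi> x = q * (1 / x * k (1 / x))" if "0 < x" for x
    using assms(13)[OF that] by (simp add: q_def)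
  have k\<psi>_nonneg: "\<And>x. 0 \<le> k\<^sub>\<psi> x" using assms(12) by (auto simp: has_pdf_def)
  obtain x\<^sub>0 where x\<^sub>0: "0 < x\<^sub>0" "k\<^sub>\<psi> x\<^sub>0 \<noteq> 0"
    using nonneg_pdf_not_null[OF \<open>prob_space N\<close> assms(12) exponential_functional_nonneg] by auto
  \<comment> \<open>If \<open>q\<close> vanished, \<open>k\<^sub>\<psi>\<close> would be null on the half-line that carries its law.\<close>
  have q: "0 < q"
  proof -
    have "0 \<le> 1 / x\<^sub>0 * k (1 / x\<^sub>0)" using x\<^sub>0 k_nonneg by simp
    moreover have "0 < k\<^sub>\<psi> x\<^sub>0"
      using x\<^sub>0 k\<psi>_nonneg[of x\<^sub>0] by (simp add: order_less_le)
    then have "0 < q * (1 / x\<^sub>0 * k (1 / x\<^sub>0))" by (simp only: k\<psi>[OF x\<^sub>0(1)])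
    ultimately show ?thesis by (metis mult_le_0_iff not_le)
  qed
  \<comment> \<open>The total mass of \<open>k\<^sub>\<psi>\<close> is \<open>q\<close> times the moment of order \<open>-1\<close> of \<open>k\<close>.\<close>
  have first_moment: "(\<integral>\<^sup>+x. ennreal (k x / x) \<partial>lborel) < \<infinity>"
  proof -
    have "(\<integral>\<^sup>+x. ennreal (indicator {0<..} x * (1 / x * k (1 / x))) \<partial>lborel) \<le>
        (\<integral>\<^sup>+x. ennreal (1 / q) * ennreal (k\<^sub>\<psi> x) \<partial>lborel)"
      using q k\<psi> k\<psi>_nonneg
      by (intro nn_integral_mono)
         (auto simp: ennreal_mult'[symmetric] indicator_def intro!: ennreal_leI)
    also have "\<dots> = ennreal (1 / q) * (\<integral>\<^sup>+x. ennreal (k\<^sub>\<psi> x) \<partial>lborel)"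
      using has_pdf_nn_integral(1)[OF \<open>prob_space N\<close> assms(12)] by (intro nn_integral_cmult) auto
    also have "\<dots> < \<infinity>"
      by (simp add: has_pdf_nn_integral(2)[OF \<open>prob_space N\<close> assms(12)])
    finally have "(\<integral>\<^sup>+x. ennreal (indicator {0<..} x * (k x / x)) \<partial>lborel) < \<infinity>"
      by (intro inverse_moment_finite_of_inversion k_meas k_nonneg)
    also have "(\<lambda>x. ennreal (indicator {0<..} x * (k x / x))) = (\<lambda>x. ennreal (k x / x))"
      using k_support by (auto simp: indicator_def inverse_drift_interval_def fun_eq_iff)
    finally show ?thesis .
  qed
  interpret regularly_varying_kernel L \<alpha>
    unfolding L_def by (rule log_tail_regularly_varying_kernel[OF \<nu> assms(4,5)])
  interpret renewal_density_equation L \<alpha> k c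
  proof
    show "(\<integral>\<^sup>+x. ennreal (k x) \<partial>lborel) = 1"
      by (rule has_pdf_nn_integral(2)[OF \<open>prob_space M\<close> k_pdf])
    fix x assume x: "x \<in> inverse_drift_interval c"
    then have x0: "0 < x" by (simp add: inverse_drift_interval_def)
    show "ennreal ((1 - c * x) * k x) = (\<integral>\<^sup>+y. ennreal (L (x / y) * k y) \<partial>lborel)"
      unfolding k_eq[OF x]
    proof (intro nn_integral_cong)
      fix y
      show "ennreal (levy_tail \<nu> (ln (y / x)) * k y) * indicator {x<..} y = ennreal (L (x / y) * k y)"
      proof (cases "x < y")
        case True
        then show ?thesis using x0 by (simp add: L_def log_tail_def ln_div)
      next
        case False
        then have "x / y \<notin> {0<..<1}"
          using x0 by (cases "0 < y") (auto simp: zero_less_divide_iff)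
        then show ?thesis using False zero_outside by simp
      qed
    qed
  qed (use k_nonneg k_meas k_support c first_moment in auto)
  define m where "m = (\<integral>\<omega>. exponential_functional \<zeta> \<omega> powr - \<alpha> \<partial>M)"
  have m: "m = (\<integral>y. y powr - \<alpha> * k y \<partial>lborel)"
    unfolding m_def using distributed_integral[OF k_dist, of "\<lambda>y. y powr - \<alpha>"] k_nonneg
    by (simp add: mult.commute)
  have m_pos: "0 < m" unfolding m by (rule inverse_moment_pos)
  have "((\<lambda>x. k (inverse x) / L (inverse x)) \<longlongrightarrow> m) at_top"
    using filterlim_compose[OF density_asymptotics filterlim_inverse_at_right_top] m by simp
  then have "((\<lambda>x. k (inverse x) / L (inverse x) / m) \<longlongrightarrow> m / m) at_top"
    using m_pos by (intro tendsto_intros) auto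
  then have "((\<lambda>x. k (inverse x) / L (inverse x) / m) \<longlongrightarrow> 1) at_top" using m_pos by simp
  moreover have "\<forall>\<^sub>F x in at_top. k (inverse x) / L (inverse x) / m =
      k\<^sub>\<psi> x / (q * m * (1 / x) * levy_tail \<nu> (ln x))"
    using eventually_gt_at_top[of 1]
  proof eventually_elim
    fix x :: real assume x: "1 < x"
    then have "L (inverse x) = levy_tail \<nu> (ln x)"
      by (simp add: L_def log_tail_def ln_inverse inverse_less_1_iff)
    then show "k (inverse x) / L (inverse x) / m = k\<^sub>\<psi> x / (q * m * (1 / x) * levy_tail \<nu> (ln x))"
      using x q m_pos k\<psi>[of x] by (simp add: inverse_eq_divide field_simps)
  qed
  ultimately show ?thesis
    unfolding q_def m_def by (rule Lim_transform_eventually)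
qed

end
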